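(* Let $n\in\mathbb{N}$, $l=\lfloor\frac{n-2}{2}\rfloor$, $m=\lfloor\frac{n-3}{2}\rfloor$, and choose $x_1,\dots,x_l,y_1,\dots,y_m\in\mathcal{S}_2$ such that $x_iy_{i+1}=y_ix_{i+1}$ for all $i$ for which all four elements are defined. For $1\le i<j\le n$ let $\alpha_{i,j}\in\mathfrak{B}_n$ be the element of corank $2$ with $i\equiv_{\alpha_{i,j}}j$ and $(n-1)'\equiv_{\alpha_{i,j}}n'$ which satisfies: (1) if $j\in\{n-1,n\}$: $s\equiv_{\alpha_{i,j}}s'$ for all $s\in M\setminus\{i,n-1,n\}$, and, if $(i,j)\ne(n-1,n)$, $\overline{j}\equiv_{\alpha_{i,j}}i'$, where $\{j,\overline{j}\}=\{n-1,n\}$; (2) if $j\le n-2$ and $j,n$ have the same parity: $s\equiv_{\alpha_{i,j}}s'$ for all $s\in\{1,\dots,j-2\}\setminus\{i\}$, and, if $i\ne j-1$, $(j-1)\equiv_{\alpha_{i,j}}i'$; (3) if $j\le n-2$ and $j,n$ have different parities: $s\equiv_{\alpha_{i,j}}s'$ for all $s\in\{1,\dots,j-1\}\setminus\{i\}$, and $(j+1)\equiv_{\alpha_{i,j}}i'$; (4) if $j\le n-2$: for every $k=1,\dots,\lfloor\frac{n-j}{2}\rfloor$ and every $s\in\{n-2k+2,n-2k+1\}$ there is $t\in\{n-2k,n-2k-1\}$ with $s\equiv_{\alpha_{i,j}}t'$; and, additionally (with $\alpha_{i,j}^{(s)}\in\mathcal{S}_2$ as defined in the context), (a) $\alpha_{i,j}^{(s)}=x_s$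 for all $(i,j)\in\mathfrak{A}_n$ and all $s=1,\dots,\lfloor\frac{n-j}{2}\rfloor$; (b) $\alpha_{i,j}^{(s)}=y_s$ for all $(i,j)\notin\mathfrak{A}_n$ with $j\le n-2$ and all $s=1,\dots,\lfloor\frac{n-j}{2}\rfloor$. Then the elements $\mathrm{id}$ and $\alpha_{i,j}$, $1\le i<j\le n$, generate a canonical $\mathcal{R}$-cross-section of $\mathfrak{B}_n$.
   Context: Let $M=\{1,\dots,n\}$, $M'=\{1',\dots,n'\}$. The Brauer semigroup $\mathfrak{B}_n$ is the set of all partitions of $M\cup M'$ into two-element subsets; write $a\equiv_\alpha b$ if $\{a,b\}\in\alpha$. The product $\alpha\beta$ is obtained by drawing $\alpha$ to the left of $\beta$ ($M$ = left pins, $M'$ = right pins), identifying each right pin $a'$ of $\alpha$ with the left pin $a$ of $\beta$, pairing the left pins of $\alpha$ and right pins of $\beta$ that are joined by a path, and discarding closed loops. $\mathfrak{B}_n$ is a monoid. $\mathrm{corank}(\alpha)$ is $n$ minus the number of blocks of the form $\{a,b'\}$, $a,b\in M$; it is even. Green's relation: $\alpha\mathcal{R}\beta$ iff $\alpha,\beta$ contain the same two-element subsets of $M$. An $\mathcal{R}$-cross-section is a subsemigroup containing exactly one element of each $\mathcal{R}$-class. An $\mathcal{R}$-cross-section $\Lambda$ is canonical if every $\alpha\in\Lambda$ of corank $2k$ satisfies $(n-2k+1)'\equiv_\alpha(n-2k+2)'$, $(n-2k+3)'\equiv_\alpha(n-2k+4)'$, ..., $(n-1)'\equiv_\alpha n'$.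 For $1\le i<j\le n-2$, an element $\alpha_{i,j}$ satisfying (4), and $s=1,\dots,\lfloor\frac{n-j}{2}\rfloor$, put $\alpha_{i,j}^{(s)}=\mathrm{id}\in\mathcal{S}_2$ if $(n-2s+2)\equiv_{\alpha_{i,j}}(n-2s)'$ and $\alpha_{i,j}^{(s)}=(1,2)\in\mathcal{S}_2$ if $(n-2s+2)\equiv_{\alpha_{i,j}}(n-2s-1)'$. $\mathfrak{A}_n$ is the set of all pairs $(n-3,n-2),(n-5,n-4),\dots$ with positive entries. *)

theory Defs
  imports "HOL-Library.Disjoint_Sets" "HOL-Combinatorics.Permutations"
begin

section \<open>The Brauer semigroup\<close>

text \<open>The pin \<open>Lpin a\<close> is $a \in M$ and the pin \<open>Rpin a\<close> is $a' \in M'$.\<close>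

datatype pin = Lpin nat | Rpin nat

type_synonym diagram = "pin set set"

definition left_pins :: "nat \<Rightarrow> pin set" where
  "left_pins n = Lpin ` {1..n}"

definition right_pins :: "nat \<Rightarrow> pin set" where
  "right_pins n = Rpin ` {1..n}"

definition brauer :: "nat \<Rightarrow> diagram set" where
  "brauer n = {a. partition_on (left_pins n \<union> right_pins n) a \<and> (\<forall>B\<in>a. card B = 2)}"

definition joined :: "diagram \<Rightarrow> pin \<Rightarrow> pin \<Rightarrow> bool" where
  "joined a p q \<longleftrightarrow> {p, q} \<in> a"

text \<open>The graph obtained by drawing \<open>a\<close> to the left of \<open>b\<close>: the vertex \<open>Mid c\<close> is the
  right pin \<open>c\<close> of \<open>a\<close> identified with the left pin \<open>c\<close> of \<open>b\<close>; the left pins of \<open>a\<close> and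
  the right pins of \<open>b\<close> are the outer vertices.\<close>

datatype vertex = Outer pin | Mid nat

fun emb_left :: "pin \<Rightarrow> vertex" where
  "emb_left (Lpin c) = Outer (Lpin c)"
| "emb_left (Rpin c) = Mid c"

fun emb_right :: "pin \<Rightarrow> vertex" where
  "emb_right (Lpin c) = Mid c"
| "emb_right (Rpin c) = Outer (Rpin c)"

definition adjacent :: "diagram \<Rightarrow> diagram \<Rightarrow> (vertex \<times> vertex) set" where
  "adjacent a b = {(u, v). {u, v} \<in> (`) emb_left ` a \<union> (`) emb_right ` b}"

text \<open>Vertices outside the graph are isolated, so the pins \<open>p \<noteq> q\<close> below are automatically
  left pins of \<open>a\<close> or right pins of \<open>b\<close>. Closed loops contain no outer vertex and disappear.\<close>

definition brauer_mult :: "diagram \<Rightarrow> diagram \<Rightarrow> diagram" where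
  "brauer_mult a b = {{p, q} | p q. p \<noteq> q \<and> (Outer p, Outer q) \<in> (adjacent a b)\<^sup>*}"

definition brauer_id :: "nat \<Rightarrow> diagram" where
  "brauer_id n = {{Lpin c, Rpin c} | c. c \<in> {1..n}}"

definition corank :: "nat \<Rightarrow> diagram \<Rightarrow> nat" where
  "corank n a = n - card {B \<in> a. \<exists>c\<in>{1..n}. \<exists>d\<in>{1..n}. B = {Lpin c, Rpin d}}"

section \<open>Cross-sections\<close>

definition green_R :: "nat \<Rightarrow> (diagram \<times> diagram) set" where
  "green_R n = {(a, b) \<in> brauer n \<times> brauer n.
     {B \<in> a. B \<subseteq> left_pins n} = {B \<in> b. B \<subseteq> left_pins n}}"

definition subsemigroup :: "nat \<Rightarrow> diagram set \<Rightarrow> bool" where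
  "subsemigroup n S \<longleftrightarrow> S \<subseteq> brauer n \<and> (\<forall>a\<in>S. \<forall>b\<in>S. brauer_mult a b \<in> S)"

definition R_cross_section :: "nat \<Rightarrow> diagram set \<Rightarrow> bool" where
  "R_cross_section n S \<longleftrightarrow>
     subsemigroup n S \<and> (\<forall>C \<in> brauer n // green_R n. \<exists>!a. a \<in> S \<inter> C)"

definition canonical_R_cross_section :: "nat \<Rightarrow> diagram set \<Rightarrow> bool" where
  "canonical_R_cross_section n S \<longleftrightarrow> R_cross_section n S \<and>
     (\<forall>a\<in>S. \<forall>k. corank n a = 2 * k \<longrightarrow>
        (\<forall>r\<in>{1..k}. joined a (Rpin (n - 2 * r + 1)) (Rpin (n - 2 * r + 2))))"

inductive_set generated :: "diagram set \<Rightarrow> diagram set" for G :: "diagram set" where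
  base: "a \<in> G \<Longrightarrow> a \<in> generated G"
| mult: "a \<in> generated G \<Longrightarrow> b \<in> generated G \<Longrightarrow> brauer_mult a b \<in> generated G"

section \<open>The generators\<close>

text \<open>The set of pairs $(n-3,n-2), (n-5,n-4), \ldots$ with positive entries.\<close>

definition A_pairs :: "nat \<Rightarrow> (nat \<times> nat) set" where
  "A_pairs n = {(i, j). 1 \<le> i \<and> 1 \<le> j \<and> (\<exists>k\<ge>1. i + 2 * k + 1 = n \<and> j + 2 * k = n)}"

text \<open>The permutation $\alpha^{(s)}$. It is used only for \<open>s\<close> in the range covered by
  \<open>cond4\<close> below, where exactly one of the two cases applies.\<close>

definition swap_part :: "nat \<Rightarrow> diagram \<Rightarrow> nat \<Rightarrow> nat \<Rightarrow> nat" where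
  "swap_part n a s =
     (if joined a (Lpin (n - 2 * s + 2)) (Rpin (n - 2 * s)) then id
      else if joined a (Lpin (n - 2 * s + 2)) (Rpin (n - 2 * s - 1)) then transpose 1 2
      else undefined)"

definition cond1 :: "nat \<Rightarrow> nat \<Rightarrow> nat \<Rightarrow> diagram \<Rightarrow> bool" where
  "cond1 n i j a \<longleftrightarrow> (j \<in> {n - 1, n} \<longrightarrow>
     (\<forall>s \<in> {1..n} - {i, n - 1, n}. joined a (Lpin s) (Rpin s)) \<and>
     ((i, j) \<noteq> (n - 1, n) \<longrightarrow>
        (\<forall>j'. {j, j'} = {n - 1, n} \<longrightarrow> joined a (Lpin j') (Rpin i))))"

definition cond2 :: "nat \<Rightarrow> nat \<Rightarrow> nat \<Rightarrow> diagram \<Rightarrow> bool" where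
  "cond2 n i j a \<longleftrightarrow> (j \<le> n - 2 \<and> even j = even n \<longrightarrow>
     (\<forall>s \<in> {1..j - 2} - {i}. joined a (Lpin s) (Rpin s)) \<and>
     (i \<noteq> j - 1 \<longrightarrow> joined a (Lpin (j - 1)) (Rpin i)))"

definition cond3 :: "nat \<Rightarrow> nat \<Rightarrow> nat \<Rightarrow> diagram \<Rightarrow> bool" where
  "cond3 n i j a \<longleftrightarrow> (j \<le> n - 2 \<and> even j \<noteq> even n \<longrightarrow>
     (\<forall>s \<in> {1..j - 1} - {i}. joined a (Lpin s) (Rpin s)) \<and>
     joined a (Lpin (j + 1)) (Rpin i))"

definition cond4 :: "nat \<Rightarrow> nat \<Rightarrow> diagram \<Rightarrow> bool" where
  "cond4 n j a \<longleftrightarrow> (j \<le> n - 2 \<longrightarrow>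
     (\<forall>k \<in> {1..(n - j) div 2}. \<forall>s \<in> {n - 2 * k + 2, n - 2 * k + 1}.
        \<exists>t \<in> {n - 2 * k, n - 2 * k - 1}. joined a (Lpin s) (Rpin t)))"

definition cond_a ::
  "nat \<Rightarrow> (nat \<Rightarrow> nat \<Rightarrow> nat) \<Rightarrow> nat \<Rightarrow> nat \<Rightarrow> diagram \<Rightarrow> bool" where
  "cond_a n x i j a \<longleftrightarrow> ((i, j) \<in> A_pairs n \<longrightarrow>
     (\<forall>s \<in> {1..(n - j) div 2}. swap_part n a s = x s))"

definition cond_b ::
  "nat \<Rightarrow> (nat \<Rightarrow> nat \<Rightarrow> nat) \<Rightarrow> nat \<Rightarrow> nat \<Rightarrow> diagram \<Rightarrow> bool" where
  "cond_b n y i j a \<longleftrightarrow> ((i, j) \<notin> A_pairs n \<and> j \<le> n - 2 \<longrightarrow>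
     (\<forall>s \<in> {1..(n - j) div 2}. swap_part n a s = y s))"

definition is_alpha ::
  "nat \<Rightarrow> (nat \<Rightarrow> nat \<Rightarrow> nat) \<Rightarrow> (nat \<Rightarrow> nat \<Rightarrow> nat) \<Rightarrow> nat \<Rightarrow> nat \<Rightarrow> diagram \<Rightarrow> bool" where
  "is_alpha n x y i j a \<longleftrightarrow>
     a \<in> brauer n \<and> corank n a = 2 \<and>
     joined a (Lpin i) (Lpin j) \<and> joined a (Rpin (n - 1)) (Rpin n) \<and>
     cond1 n i j a \<and> cond2 n i j a \<and> cond3 n i j a \<and> cond4 n j a \<and>
     cond_a n x i j a \<and> cond_b n y i j a"

definition alpha ::
  "nat \<Rightarrow> (nat \<Rightarrow> nat \<Rightarrow> nat) \<Rightarrow> (nat \<Rightarrow> nat \<Rightarrow> nat) \<Rightarrow> nat \<Rightarrow> nat \<Rightarrow> diagram" where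
  "alpha n x y i j = (THE a. is_alpha n x y i j a)"

end

(*
  Count the pins from the top by u = n - c and call {2r, 2r+1} a block. Each alpha_{i,j} is given by
  a permutation of the coordinates (below: slide) that moves the joined pair p = n - j, q = n - i to
  block 0, shifts every block numbered below that of p by one, and moves the second element of the
  block of p to the place of q. A canonical diagram of corank 2k is likewise given
  by a permutation f, where left pins that land in one of the blocks 0, ..., k-1 are joined.
  Multiplying it by alpha_{i,j} composes the permutations if p >= 2k, and changes nothing otherwise.

  Hence the products are obtained by matching up left pins pair by pair, and every matching is
  reached, so every R-class is met. That it is met only once means that the order of the pairs does
  not matter. By induction this reduces to exchanging two consecutive pairs, where it is an identity
  between slides; the condition x_i y_{i+1} = y_i x_{i+1} is exactly what makes it true.
*)

theory Submission
  imports Defs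
begin

section \<open>Associativity\<close>

text \<open>Since S_2 is commutative, the condition on x and y says that x_s y_s does not depend on
  s: either x_s = y_s throughout, or they differ throughout. One truth value \<open>d\<close> thus
  encodes y by x, and all shifts commute with each other. The obstacle is that the permutation f is
  not determined by the diagram: on pins already matched it remembers the order of the pairs. So
  uniqueness is claimed only for values outside the first k blocks, which is all that
  \<open>canon\<close> retains besides the matching. When two products end in different pairs P and
  Q, both are removed from the matching and the rest is reached by some h; induction identifies the
  product without its last pair P with h followed by Q, the other with h followed by P, and the
  exchange finishes. Only multiplication by a generator on the right is computed. Closure under all
  products then rests on associativity, which is not evident for a product defined by connectivity.
  Single products are found by labelling vertices so that labels are constant along edges, with
  explicit paths between outer vertices of equal label.\<close>

lemma image_eq_doubleton:
  assumes "inj h"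
  shows "{u, v} = h ` B \<longleftrightarrow> (\<exists>p q. u = h p \<and> v = h q \<and> B = {p, q})"
proof
  assume uv: "{u, v} = h ` B"
  have "u \<in> h ` B" "v \<in> h ` B" by (simp_all flip: uv)
  then obtain p q where "u = h p" "v = h q" by blast
  with uv have "h ` B = h ` {p, q}" by simp
  with assms have "B = {p, q}" by (metis inj_image_eq_iff)
  with \<open>u = h p\<close> \<open>v = h q\<close> show "\<exists>p q. u = h p \<and> v = h q \<and> B = {p, q}" by blast
qed auto

lemma inj_emb: "inj emb_left" "inj emb_right"
  unfolding inj_def
  by (intro allI; case_tac x; case_tac y; simp)+

text \<open>The embedding \<open>h\<close> is a parameter: the same diagram is drawn with vertices
  of type \<open>vertex\<close> for the product and in numbered columns for associativity.\<close>

definition edges :: "(pin \<Rightarrow> 'v) \<Rightarrow> diagram \<Rightarrow> ('v \<times> 'v) set" where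
  "edges h a = {(h p, h q) | p q. {p, q} \<in> a}"

lemma edges_iff: "(u, v) \<in> edges h a \<longleftrightarrow> (\<exists>p q. {p, q} \<in> a \<and> u = h p \<and> v = h q)"
  by (auto simp: edges_def)

lemma adjacent_eq: "adjacent a b = edges emb_left a \<union> edges emb_right b"
  unfolding adjacent_def edges_def
  by (auto simp: image_iff image_eq_doubleton[OF inj_emb(1)] image_eq_doubleton[OF inj_emb(2)]) blast+

lemma sym_edges: "sym (edges h a)"
  by (auto simp: sym_def edges_def) (metis insert_commute)

lemma rtrancl_map_prod_iff:
  assumes "inj h"
  shows "(h x, h y) \<in> (map_prod h h ` r)\<^sup>* \<longleftrightarrow> (x, y) \<in> r\<^sup>*"
proof
  have "\<forall>x y. u = h x \<longrightarrow> v = h y \<longrightarrow> (x, y) \<in> r\<^sup>*" if "(u, v) \<in> (map_prod h h ` r)\<^sup>*" for u v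
    using that
  proof (induction rule: rtrancl_induct)
    case base
    then show ?case using assms by (auto simp: inj_eq)
  next
    case (step v w)
    then obtain y z where "v = h y" "w = h z" "(y, z) \<in> r" by auto
    with step.IH assms show ?case by (metis inj_eq rtrancl.rtrancl_into_rtrancl)
  qed
  then show "(h x, h y) \<in> (map_prod h h ` r)\<^sup>* \<Longrightarrow> (x, y) \<in> r\<^sup>*" by blast
  show "(x, y) \<in> r\<^sup>* \<Longrightarrow> (h x, h y) \<in> (map_prod h h ` r)\<^sup>*"
    by (induction rule: rtrancl_induct) (auto intro: rtrancl.rtrancl_into_rtrancl)
qed

text \<open>\<open>vertex\<close> knows one middle column only, while three diagrams side by side
  need two. A vertex is now a column number with a pin number, so the columns that a diagram joins
  can be chosen freely.\<close>

fun column :: "nat \<Rightarrow> nat \<Rightarrow> pin \<Rightarrow> nat \<times> nat" where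
  "column i j (Lpin c) = (i, c)"
| "column i j (Rpin c) = (j, c)"

fun place :: "nat \<Rightarrow> nat \<Rightarrow> nat \<Rightarrow> vertex \<Rightarrow> nat \<times> nat" where
  "place i j k (Outer p) = column i k p"
| "place i j k (Mid c) = (j, c)"

lemma inj_column: "i \<noteq> j \<Longrightarrow> inj (column i j)"
  unfolding inj_def by (intro allI; case_tac x; case_tac y; simp)

lemma inj_place:
  assumes "i \<noteq> j" "i \<noteq> k" "j \<noteq> k"
  shows "inj (place i j k)"
proof (rule injI)
  have [simp]: "column i k p \<noteq> (j, c)" "(j, c) \<noteq> column i k p" for p c
    using assms by (cases p; simp)+
  fix u v assume "place i j k u = place i j k v"
  then show "u = v"
    by (cases u; cases v) (simp_all add: inj_eq[OF inj_column[OF assms(2)]])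
qed

lemma place_emb: "place i j k (emb_left p) = column i j p" "place i j k (emb_right p) = column j k p"
  by (cases p; simp)+

lemma place_adjacent:
  "map_prod (place i j k) (place i j k) ` adjacent a b = edges (column i j) a \<union> edges (column j k) b"
  unfolding adjacent_eq image_Un edges_def
  by (intro arg_cong2[where f = "(\<union>)"] set_eqI) (force simp: image_iff place_emb)+

lemma mem_brauer_mult:
  "{p, q} \<in> brauer_mult a b \<longleftrightarrow> p \<noteq> q \<and> (Outer p, Outer q) \<in> (adjacent a b)\<^sup>*"
proof -
  have "sym ((adjacent a b)\<^sup>*)"
    unfolding adjacent_eq by (intro sym_rtrancl sym_Un sym_edges)
  then show ?thesis
    unfolding brauer_mult_def by (auto simp: doubleton_eq_iff dest: symD)
qed

lemma mem_brauer_mult_column: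
  assumes "i \<noteq> j" "i \<noteq> k" "j \<noteq> k"
  shows "{p, q} \<in> brauer_mult a b \<longleftrightarrow>
    p \<noteq> q \<and> (column i k p, column i k q) \<in> (edges (column i j) a \<union> edges (column j k) b)\<^sup>*"
  using rtrancl_map_prod_iff[OF inj_place[OF assms], of "Outer p" "Outer q" "adjacent a b"]
  by (simp add: place_adjacent mem_brauer_mult)

text \<open>A path between points of S is cut at its \<open>s\<close>-steps, whose ends lie in S;
  the pieces between them are \<open>r\<close>-paths from S to S.\<close>

lemma rtrancl_contract:
  assumes s: "s \<subseteq> S \<times> S" and x: "x \<in> S" and y: "y \<in> S"
  shows "(x, y) \<in> (r \<union> s)\<^sup>* \<longleftrightarrow> (x, y) \<in> (r\<^sup>* \<inter> S \<times> S \<union> s)\<^sup>*"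
proof
  assume "(x, y) \<in> (r \<union> s)\<^sup>*"
  \<comment> \<open>Here w is the point of S at which the current run of \<open>r\<close>-steps
    began.\<close>
  then have "\<exists>w\<in>S. (x, w) \<in> (r\<^sup>* \<inter> S \<times> S \<union> s)\<^sup>* \<and> (w, y) \<in> r\<^sup>*"
  proof (induction rule: rtrancl_induct)
    case base
    then show ?case using x by blast
  next
    case (step y z)
    then obtain w where w: "w \<in> S" "(x, w) \<in> (r\<^sup>* \<inter> S \<times> S \<union> s)\<^sup>*" "(w, y) \<in> r\<^sup>*" by blast
    show ?case
    proof (cases "(y, z) \<in> r")
      case True
      then show ?thesis using w by (meson rtrancl.rtrancl_into_rtrancl)
    next
      case False
      with step have "(y, z) \<in> s" by blast
      with s have "y \<in> S" "z \<in> S" by auto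
      with w have "(x, y) \<in> (r\<^sup>* \<inter> S \<times> S \<union> s)\<^sup>*"
        by (meson IntI SigmaI UnI1 rtrancl.rtrancl_into_rtrancl)
      with \<open>(y, z) \<in> s\<close> \<open>z \<in> S\<close> show ?thesis
        by (meson UnI2 rtrancl.rtrancl_into_rtrancl rtrancl.rtrancl_refl)
    qed
  qed
  then show "(x, y) \<in> (r\<^sup>* \<inter> S \<times> S \<union> s)\<^sup>*"
    using y by (meson IntI SigmaI UnI1 rtrancl.rtrancl_into_rtrancl)
next
  assume "(x, y) \<in> (r\<^sup>* \<inter> S \<times> S \<union> s)\<^sup>*"
  moreover have "r\<^sup>* \<inter> S \<times> S \<union> s \<subseteq> (r \<union> s)\<^sup>*"
    by (auto intro: subsetD[OF rtrancl_mono, of r])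
  ultimately show "(x, y) \<in> (r \<union> s)\<^sup>*"
    using rtrancl_subset_rtrancl by blast
qed

lemma range_column: "range (column i j) = {i, j} \<times> UNIV"
proof
  show "range (column i j) \<subseteq> {i, j} \<times> UNIV"
    by (rule image_subsetI, case_tac x) simp_all
  have "(i, c) \<in> range (column i j)" "(j, c) \<in> range (column i j)" for c
    using rangeI[of "column i j" "Lpin c"] rangeI[of "column i j" "Rpin c"] by simp_all
  then show "{i, j} \<times> UNIV \<subseteq> range (column i j)" by blast
qed

lemma edges_column_subset: "edges (column i j) a \<subseteq> ({i, j} \<times> UNIV) \<times> ({i, j} \<times> UNIV)"
  unfolding edges_def range_column[symmetric] by blast

text \<open>Multiplication contracts the middle column j. This stays correct inside a larger graph
  because \<open>s\<close> does not touch that column; for associativity, \<open>s\<close> is the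
  third diagram.\<close>

lemma rtrancl_edges_brauer_mult:
  assumes d: "i \<noteq> j" "i \<noteq> k" "j \<noteq> k"
    and s: "s \<subseteq> ((- {j}) \<times> UNIV) \<times> ((- {j}) \<times> UNIV)"
    and x: "x \<in> (- {j}) \<times> UNIV" and y: "y \<in> (- {j}) \<times> UNIV"
  shows "(x, y) \<in> (edges (column i k) (brauer_mult a b) \<union> s)\<^sup>* \<longleftrightarrow>
    (x, y) \<in> (edges (column i j) a \<union> edges (column j k) b \<union> s)\<^sup>*"
proof -
  let ?r = "edges (column i j) a \<union> edges (column j k) b" and ?S = "(- {j}) \<times> UNIV :: (nat \<times> nat) set"
  have 1: "edges (column i k) (brauer_mult a b) \<subseteq> ?r\<^sup>* \<inter> ?S \<times> ?S"
  proof -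
    have "edges (column i k) (brauer_mult a b) \<subseteq> ?r\<^sup>*"
      unfolding edges_def[of "column i k"] by (auto simp: mem_brauer_mult_column[OF d])
    moreover have "edges (column i k) (brauer_mult a b) \<subseteq> ?S \<times> ?S"
      using edges_column_subset[of i k "brauer_mult a b"] d by fastforce
    ultimately show ?thesis by blast
  qed
  have 2: "?r\<^sup>* \<inter> ?S \<times> ?S \<subseteq> (edges (column i k) (brauer_mult a b))\<^sup>*"
  proof
    fix z assume z: "z \<in> ?r\<^sup>* \<inter> ?S \<times> ?S"
    obtain u v where uv: "z = (u, v)" by (cases z)
    show "z \<in> (edges (column i k) (brauer_mult a b))\<^sup>*"
    \<comment> \<open>A product contains no block with equal ends, so the empty path has to be
      treated apart.\<close>
    proof (cases "u = v")
      case False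
      with z uv have "(u, v) \<in> ?r\<^sup>+" by (auto simp: rtrancl_eq_or_trancl)
      then have "u \<in> Domain ?r" "v \<in> Range ?r" by (blast dest: tranclD tranclD2)+
      then have "u \<in> {i, j, k} \<times> UNIV" "v \<in> {i, j, k} \<times> UNIV"
        using edges_column_subset[of i j a] edges_column_subset[of j k b] by fastforce+
      with z uv have "u \<in> {i, k} \<times> UNIV" "v \<in> {i, k} \<times> UNIV" by auto
      then obtain p q where pq: "u = column i k p" "v = column i k q"
        unfolding range_column[symmetric] by blast
      with z uv False have "{p, q} \<in> brauer_mult a b"
        unfolding mem_brauer_mult_column[OF d] by auto
      with pq have "(u, v) \<in> edges (column i k) (brauer_mult a b)"
        unfolding edges_iff by blast
      with uv show ?thesis by blast
    qed (use uv in simp)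
  qed
  have "(?r\<^sup>* \<inter> ?S \<times> ?S \<union> s)\<^sup>* = (edges (column i k) (brauer_mult a b) \<union> s)\<^sup>*"
  proof (rule rtrancl_subset)
    show "edges (column i k) (brauer_mult a b) \<union> s \<subseteq> ?r\<^sup>* \<inter> ?S \<times> ?S \<union> s" using 1 by blast
    show "?r\<^sup>* \<inter> ?S \<times> ?S \<union> s \<subseteq> (edges (column i k) (brauer_mult a b) \<union> s)\<^sup>*"
      using 2 rtrancl_mono[of "edges (column i k) (brauer_mult a b)" "edges (column i k) (brauer_mult a b) \<union> s"]
      by blast
  qed
  with rtrancl_contract[OF s x y, of ?r] show ?thesis by simp
qed

lemma diagram_eqI:
  assumes "\<And>B. B \<in> a \<Longrightarrow> \<exists>p q. B = {p, q}" "\<And>B. B \<in> b \<Longrightarrow> \<exists>p q. B = {p, q}"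
    and "\<And>p q. {p, q} \<in> a \<longleftrightarrow> {p, q} \<in> b"
  shows "a = b"
  using assms by (metis subsetI subset_antisym)

text \<open>Both sides describe connectivity in the graph that has \<open>a\<close>, \<open>b\<close>, \<open>c\<close> drawn between the
  columns 0, 1, 2, 3; they differ in whether column 1 or column 2 is contracted first.\<close>

theorem brauer_mult_assoc: "brauer_mult (brauer_mult a b) c = brauer_mult a (brauer_mult b c)"
proof (rule diagram_eqI)
  fix p q
  have *: "column 0 3 p \<in> (- {Suc 0}) \<times> UNIV" "column 0 3 q \<in> (- {Suc 0}) \<times> UNIV"
    "column 0 3 p \<in> (- {2}) \<times> UNIV" "column 0 3 q \<in> (- {2}) \<times> UNIV"
    by (cases p; cases q; simp)+
  have s: "edges (column 2 3) c \<subseteq> ((- {Suc 0}) \<times> UNIV) \<times> ((- {Suc 0}) \<times> UNIV)"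
    "edges (column 0 1) a \<subseteq> ((- {2}) \<times> UNIV) \<times> ((- {2}) \<times> UNIV)"
    using edges_column_subset[of 2 3 c] edges_column_subset[of 0 1 a] by fastforce+
  have "(column 0 3 p, column 0 3 q) \<in> (edges (column 0 2) (brauer_mult a b) \<union> edges (column 2 3) c)\<^sup>* \<longleftrightarrow>
    (column 0 3 p, column 0 3 q) \<in> (edges (column 0 1) a \<union> edges (column 1 2) b \<union> edges (column 2 3) c)\<^sup>*"
    by (rule rtrancl_edges_brauer_mult) (use * s in auto)
  moreover have "(column 0 3 p, column 0 3 q) \<in> (edges (column 1 3) (brauer_mult b c) \<union> edges (column 0 1) a)\<^sup>* \<longleftrightarrow>
    (column 0 3 p, column 0 3 q) \<in> (edges (column 1 2) b \<union> edges (column 2 3) c \<union> edges (column 0 1) a)\<^sup>*"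
    by (rule rtrancl_edges_brauer_mult) (use * s in auto)
  ultimately show "{p, q} \<in> brauer_mult (brauer_mult a b) c \<longleftrightarrow> {p, q} \<in> brauer_mult a (brauer_mult b c)"
    using mem_brauer_mult_column[of 0 2 3 p q "brauer_mult a b" c]
      mem_brauer_mult_column[of 0 1 3 p q a "brauer_mult b c"]
    by (simp add: Un_ac)
qed (auto simp: brauer_mult_def)

section \<open>Diagrams given by labels\<close>

definition pins :: "nat \<Rightarrow> pin set" where
  "pins n = left_pins n \<union> right_pins n"

text \<open>Pins are counted from the top: the pins \<open>c\<close> and \<open>c'\<close> have the coordinate \<open>n - c\<close>.\<close>

lemma pins_cases:
  assumes "p \<in> pins n"
  obtains u where "u < n" "p = Lpin (n - u)" | u where "u < n" "p = Rpin (n - u)"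
proof -
  consider c where "c \<in> {1..n}" "p = Lpin c" | c where "c \<in> {1..n}" "p = Rpin c"
    using assms unfolding pins_def left_pins_def right_pins_def by blast
  then show thesis
  proof cases
    case (1 c)
    then show thesis using that(1)[of "n - c"] by auto
  next
    case (2 c)
    then show thesis using that(2)[of "n - c"] by auto
  qed
qed

lemma mem_pins: "Lpin c \<in> pins n \<longleftrightarrow> 1 \<le> c \<and> c \<le> n" "Rpin c \<in> pins n \<longleftrightarrow> 1 \<le> c \<and> c \<le> n"
  unfolding pins_def left_pins_def right_pins_def by auto

text \<open>Diagrams are presented by the fibres of a label function, so that a product can be
  computed by finding labels for the composed graph.\<close>

definition labelled :: "nat \<Rightarrow> (pin \<Rightarrow> 'l) \<Rightarrow> diagram" where
  "labelled n l = {{p, q} | p q. p \<in> pins n \<and> q \<in> pins n \<and> p \<noteq> q \<and> l p = l q}"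

lemma mem_labelled:
  "{p, q} \<in> labelled n l \<longleftrightarrow> p \<in> pins n \<and> q \<in> pins n \<and> p \<noteq> q \<and> l p = l q"
  unfolding labelled_def by (auto simp: doubleton_eq_iff)

lemma Outer_adjacentD:
  assumes "(Outer p, v) \<in> adjacent (labelled n l) (labelled n l')"
  shows "p \<in> pins n"
proof -
  have "Outer p = emb_left q \<Longrightarrow> p = q" "Outer p = emb_right q \<Longrightarrow> p = q" for q
    by (cases q; simp)+
  with assms show ?thesis
    unfolding adjacent_eq Un_iff edges_iff mem_labelled by blast
qed

lemma sym_rtrancl_adjacent: "sym ((adjacent a b)\<^sup>*)"
  unfolding adjacent_eq by (intro sym_rtrancl sym_Un sym_edges)

text \<open>\<open>V\<close> labels the composed graph. The first two assumptions make it constant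
  along edges, hence on components; by the third it tells components apart on outer vertices.
  Components without outer vertices need not be told apart, so closed loops cause no
  trouble.\<close>

lemma labelled_mult:
  assumes l: "\<And>p q. p \<in> pins n \<Longrightarrow> q \<in> pins n \<Longrightarrow> l p = l q \<Longrightarrow> V (emb_left p) = V (emb_left q)"
    and l': "\<And>p q. p \<in> pins n \<Longrightarrow> q \<in> pins n \<Longrightarrow> l' p = l' q \<Longrightarrow> V (emb_right p) = V (emb_right q)"
    and V: "\<And>p q. p \<in> pins n \<Longrightarrow> q \<in> pins n \<Longrightarrow> V (Outer p) = V (Outer q) \<Longrightarrow>
      (Outer p, Outer q) \<in> (adjacent (labelled n l) (labelled n l'))\<^sup>*"
  shows "brauer_mult (labelled n l) (labelled n l') = labelled n (\<lambda>p. V (Outer p))"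
proof (rule diagram_eqI)
  fix p q
  let ?adj = "adjacent (labelled n l) (labelled n l')"
  have step: "V u = V v" if "(u, v) \<in> ?adj" for u v
    using that l l' unfolding adjacent_eq Un_iff edges_iff mem_labelled by blast
  have V': "V u = V v" if "(u, v) \<in> ?adj\<^sup>*" for u v
    using that by (induction rule: rtrancl_induct) (auto dest: step)
  have pin: "p \<in> pins n" if "(Outer p, Outer q) \<in> ?adj\<^sup>*" "p \<noteq> q" for p q
    using that by (auto elim: converse_rtranclE dest: Outer_adjacentD)
  then have "q \<in> pins n" if "(Outer p, Outer q) \<in> ?adj\<^sup>*" "p \<noteq> q"
    using that symD[OF sym_rtrancl_adjacent] by metis
  with pin V V' show "{p, q} \<in> brauer_mult (labelled n l) (labelled n l') \<longleftrightarrow>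
      {p, q} \<in> labelled n (\<lambda>p. V (Outer p))"
    unfolding mem_brauer_mult mem_labelled by blast
qed (auto simp: brauer_mult_def labelled_def)

text \<open>Labels tagged 0 occur only on the left, labels tagged 1 only on the right: so in
  \<open>canon n k f\<close> the left pin \<open>u\<close> is joined to the right pin \<open>f u\<close>, except that the left pins sent
  to one of the first \<open>k\<close> blocks are joined to each other.\<close>

definition lcode :: "nat \<Rightarrow> nat \<Rightarrow> nat \<times> nat" where
  "lcode k v = (if v < 2 * k then (0, v div 2) else (2, v))"

definition rcode :: "nat \<Rightarrow> nat \<Rightarrow> nat \<times> nat" where
  "rcode k v = (if v < 2 * k then (1, v div 2) else (2, v))"

fun canon_label :: "nat \<Rightarrow> nat \<Rightarrow> (nat \<Rightarrow> nat) \<Rightarrow> pin \<Rightarrow> nat \<times> nat" where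
  "canon_label n k f (Lpin c) = lcode k (f (n - c))"
| "canon_label n k f (Rpin c) = rcode k (n - c)"

definition canon :: "nat \<Rightarrow> nat \<Rightarrow> (nat \<Rightarrow> nat) \<Rightarrow> diagram" where
  "canon n k f = labelled n (canon_label n k f)"

lemma canon_joined:
  assumes "u < n" "v < n"
  shows "{Lpin (n - u), Lpin (n - v)} \<in> canon n k f \<longleftrightarrow> u \<noteq> v \<and> lcode k (f u) = lcode k (f v)"
    and "{Rpin (n - u), Rpin (n - v)} \<in> canon n k f \<longleftrightarrow> u \<noteq> v \<and> rcode k u = rcode k v"
    and "{Lpin (n - u), Rpin (n - v)} \<in> canon n k f \<longleftrightarrow> lcode k (f u) = rcode k v"
  using assms unfolding canon_def mem_labelled by (auto simp: mem_pins)

lemma code_eq_iff: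
  "lcode k u = lcode k v \<longleftrightarrow> u = v \<or> u < 2 * k \<and> v < 2 * k \<and> u div 2 = v div 2"
  "rcode k u = rcode k v \<longleftrightarrow> u = v \<or> u < 2 * k \<and> v < 2 * k \<and> u div 2 = v div 2"
  "lcode k u = rcode k v \<longleftrightarrow> u = v \<and> \<not> u < 2 * k"
  unfolding lcode_def rcode_def by auto

text \<open>The edges of the composed graph, sorted by the kinds of their ends. Where both ends are
  the same vertex, the empty path serves instead of an edge.\<close>

lemma canon_mult_edges:
  fixes n k m f h
  assumes "u < n" "v < n"
  defines "conn \<equiv> (adjacent (canon n k f) (canon n m h))\<^sup>*"
  shows "lcode k (f u) = lcode k (f v) \<Longrightarrow> (Outer (Lpin (n - u)), Outer (Lpin (n - v))) \<in> conn"
    and "lcode k (f u) = rcode k v \<Longrightarrow> (Outer (Lpin (n - u)), Mid (n - v)) \<in> conn"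
    and "rcode k u = rcode k v \<Longrightarrow> (Mid (n - u), Mid (n - v)) \<in> conn"
    and "lcode m (h u) = lcode m (h v) \<Longrightarrow> (Mid (n - u), Mid (n - v)) \<in> conn"
    and "lcode m (h u) = rcode m v \<Longrightarrow> (Mid (n - u), Outer (Rpin (n - v))) \<in> conn"
    and "rcode m u = rcode m v \<Longrightarrow> (Outer (Rpin (n - u)), Outer (Rpin (n - v))) \<in> conn"
proof -
  have 1: "{p, q} \<in> canon n k f \<Longrightarrow> (emb_left p, emb_left q) \<in> conn"
    and 2: "{p, q} \<in> canon n m h \<Longrightarrow> (emb_right p, emb_right q) \<in> conn" for p q
    unfolding conn_def adjacent_eq by (blast intro: r_into_rtrancl iffD2[OF edges_iff])+
  have refl: "(x, x) \<in> conn" for x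
    unfolding conn_def by simp
  note e = 1[of "Lpin (n - u)" "Lpin (n - v)"] 1[of "Lpin (n - u)" "Rpin (n - v)"]
    1[of "Rpin (n - u)" "Rpin (n - v)"] 2[of "Lpin (n - u)" "Lpin (n - v)"]
    2[of "Lpin (n - u)" "Rpin (n - v)"] 2[of "Rpin (n - u)" "Rpin (n - v)"]
  note e' = e[unfolded canon_joined[OF assms(1,2)], simplified]
  show "lcode k (f u) = lcode k (f v) \<Longrightarrow> (Outer (Lpin (n - u)), Outer (Lpin (n - v))) \<in> conn"
    by (cases "u = v") (use e'(1) refl in auto)
  show "lcode k (f u) = rcode k v \<Longrightarrow> (Outer (Lpin (n - u)), Mid (n - v)) \<in> conn"
    by (rule e'(2))
  show "rcode k u = rcode k v \<Longrightarrow> (Mid (n - u), Mid (n - v)) \<in> conn"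
    by (cases "u = v") (use e'(3) refl in auto)
  show "lcode m (h u) = lcode m (h v) \<Longrightarrow> (Mid (n - u), Mid (n - v)) \<in> conn"
    by (cases "u = v") (use e'(4) refl in auto)
  show "lcode m (h u) = rcode m v \<Longrightarrow> (Mid (n - u), Outer (Rpin (n - v))) \<in> conn"
    by (rule e'(5))
  show "rcode m u = rcode m v \<Longrightarrow> (Outer (Rpin (n - u)), Outer (Rpin (n - v))) \<in> conn"
    by (cases "u = v") (use e'(6) refl in auto)
qed

text \<open>Outer vertices carry the labels of the expected result, and \<open>g\<close> labels the
  middle ones. The assumptions \<open>a\<close> and \<open>b\<close> are constancy along the edges
  of the two factors, \<open>c\<close> provides the paths. Each product below amounts to a choice of
  \<open>g\<close>.\<close>

lemma canon_mult:
  fixes n k m k' f h f' g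
  defines "conn \<equiv> (adjacent (canon n k f) (canon n m h))\<^sup>*"
  assumes a: "\<And>u v. u < n \<Longrightarrow> v < n \<Longrightarrow> lcode k (f u) = lcode k (f v) \<Longrightarrow> lcode k' (f' u) = lcode k' (f' v)"
      "\<And>u v. u < n \<Longrightarrow> v < n \<Longrightarrow> lcode k (f u) = rcode k v \<Longrightarrow> lcode k' (f' u) = g v"
      "\<And>u v. u < n \<Longrightarrow> v < n \<Longrightarrow> rcode k u = rcode k v \<Longrightarrow> g u = g v"
    and b: "\<And>u v. u < n \<Longrightarrow> v < n \<Longrightarrow> lcode m (h u) = lcode m (h v) \<Longrightarrow> g u = g v"
      "\<And>u v. u < n \<Longrightarrow> v < n \<Longrightarrow> lcode m (h u) = rcode m v \<Longrightarrow> g u = rcode k' v"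
      "\<And>u v. u < n \<Longrightarrow> v < n \<Longrightarrow> rcode m u = rcode m v \<Longrightarrow> rcode k' u = rcode k' v"
    and c: "\<And>u v. u < n \<Longrightarrow> v < n \<Longrightarrow> lcode k' (f' u) = lcode k' (f' v) \<Longrightarrow>
        (Outer (Lpin (n - u)), Outer (Lpin (n - v))) \<in> conn"
      "\<And>u v. u < n \<Longrightarrow> v < n \<Longrightarrow> lcode k' (f' u) = rcode k' v \<Longrightarrow>
        (Outer (Lpin (n - u)), Outer (Rpin (n - v))) \<in> conn"
      "\<And>u v. u < n \<Longrightarrow> v < n \<Longrightarrow> rcode k' u = rcode k' v \<Longrightarrow>
        (Outer (Rpin (n - u)), Outer (Rpin (n - v))) \<in> conn"
  shows "brauer_mult (canon n k f) (canon n m h) = canon n k' f'"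
proof -
  define V where "V = case_vertex (canon_label n k' f') (\<lambda>d. g (n - d))"
  have V: "V (Outer p) = canon_label n k' f' p" "V (Mid d) = g (n - d)" for p d
    by (simp_all add: V_def)
  have c2: "(Outer (Rpin (n - v)), Outer (Lpin (n - u))) \<in> conn"
    if "u < n" "v < n" "lcode k' (f' u) = rcode k' v" for u v
    using c(2)[OF that] sym_rtrancl_adjacent unfolding conn_def by (rule symD[rotated])
  have "brauer_mult (canon n k f) (canon n m h) = labelled n (\<lambda>p. V (Outer p))"
    unfolding canon_def
  proof (rule labelled_mult)
    fix p q assume "p \<in> pins n" "q \<in> pins n" "canon_label n k f p = canon_label n k f q"
    then show "V (emb_left p) = V (emb_left q)"
      by (elim pins_cases) (auto simp: V intro: a a[symmetric])
  next
    fix p q assume "p \<in> pins n" "q \<in> pins n" "canon_label n m h p = canon_label n m h q"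
    then show "V (emb_right p) = V (emb_right q)"
      by (elim pins_cases) (auto simp: V intro: b b[symmetric])
  next
    fix p q assume "p \<in> pins n" "q \<in> pins n" "V (Outer p) = V (Outer q)"
    then have "(Outer p, Outer q) \<in> conn"
      by (elim pins_cases) (auto simp: V intro: c c2)
    then show "(Outer p, Outer q) \<in> (adjacent (labelled n (canon_label n k f)) (labelled n (canon_label n m h)))\<^sup>*"
      by (simp add: conn_def canon_def)
  qed
  then show ?thesis by (simp add: V canon_def)
qed

section \<open>The generators as canonical diagrams\<close>

text \<open>In block \<open>r\<close>, consisting of the coordinates \<open>2r\<close> and \<open>2r+1\<close>, the shift towards block
  \<open>r+1\<close> is by the permutation $x_{r+1}$ if the joined pair is a block and by $y_{r+1}$
  otherwise. \<open>X s\<close> says that $x_s$ is not the identity; by the condition on $x$ and $y$ there is a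
  \<open>d\<close> independent of \<open>s\<close> that says whether $x_s$ and $y_s$ differ.\<close>

definition shift :: "(nat \<Rightarrow> bool) \<Rightarrow> bool \<Rightarrow> nat \<Rightarrow> nat" where
  "shift X t u = 2 * (u div 2 + 1) + (if X (u div 2 + 1) \<noteq> t then 1 - u mod 2 else u mod 2)"

text \<open>\<open>min\<close> and \<open>max\<close> make the map symmetric in the pair, because
  the order of two pins may have been reversed by earlier slides. The twist \<open>d\<close> is
  suppressed exactly when the pair is a block, which turns y back into x.\<close>

definition slide :: "(nat \<Rightarrow> bool) \<Rightarrow> bool \<Rightarrow> nat \<Rightarrow> nat \<Rightarrow> nat \<Rightarrow> nat" where
  "slide X d p q u = (let a = min p q; b = max p q in
     if u = a then 0 else if u = b then 1
     else if u div 2 < a div 2 then shift X (d \<and> a div 2 \<noteq> b div 2) u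
     else if u div 2 = a div 2 then b else u)"

lemma slide_commute: "slide X d p q = slide X d q p"
  by (simp add: slide_def fun_eq_iff min.commute max.commute)

lemma shift_div: "shift X t u div 2 = u div 2 + 1"
  by (simp add: shift_def)

lemma shift_inject: 
  assumes "shift X t u = shift X t v"
  shows "u = v"
proof -
  have uv: "u div 2 = v div 2"
    using assms shift_div[of X t u] shift_div[of X t v] by simp
  then have "u mod 2 = v mod 2"
    using assms unfolding shift_def by (auto split: if_splits)
  with uv show ?thesis by (metis div_mult_mod_eq)
qed

section \<open>Elementary properties of a slide\<close>

context
  fixes X :: "nat \<Rightarrow> bool" and d :: bool and p q :: nat
  assumes pq: "p < q"
begin

lemma slide_simps:
  "slide X d p q p = 0" "slide X d p q q = 1"
  "u \<noteq> p \<Longrightarrow> u \<noteq> q \<Longrightarrow> u div 2 < p div 2 \<Longrightarrow>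
    slide X d p q u = shift X (d \<and> p div 2 \<noteq> q div 2) u"
  "u \<noteq> p \<Longrightarrow> u \<noteq> q \<Longrightarrow> u div 2 = p div 2 \<Longrightarrow> slide X d p q u = q"
  "u \<noteq> p \<Longrightarrow> u \<noteq> q \<Longrightarrow> p div 2 < u div 2 \<Longrightarrow> slide X d p q u = u"
  using pq by (auto simp: slide_def Let_def min_def max_def)

lemma slide_div:
  assumes "u div 2 < p div 2"
  shows "slide X d p q u div 2 = u div 2 + 1"
proof -
  have "u \<noteq> p" "u \<noteq> q"
    using assms div_le_mono[of p q 2] pq by auto
  then show ?thesis
    using slide_simps(3) assms shift_div by metis
qed

lemma slide_cases:
  obtains "u = p" "slide X d p q u = 0" | "u = q" "slide X d p q u = 1"
  | "u \<noteq> p" "u \<noteq> q" "u div 2 < p div 2" "slide X d p q u = shift X (d \<and> p div 2 \<noteq> q div 2) u"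
    "slide X d p q u div 2 = u div 2 + 1"
  | "u \<noteq> p" "u \<noteq> q" "u div 2 = p div 2" "slide X d p q u = q" "p div 2 < q div 2"
  | "u \<noteq> p" "u \<noteq> q" "p div 2 < u div 2" "slide X d p q u = u"
proof -
  consider "u = p" | "u = q" | "u \<noteq> p" "u \<noteq> q" "u div 2 < p div 2"
    | "u \<noteq> p" "u \<noteq> q" "u div 2 = p div 2" | "u \<noteq> p" "u \<noteq> q" "p div 2 < u div 2"
    by linarith
  then show thesis
  proof cases
    case 1
    then show thesis by (intro that(1)) (simp_all add: slide_simps(1))
  next
    case 2
    then show thesis by (intro that(2)) (simp_all add: slide_simps(2))
  next
    case 3
    then show thesis by (intro that(3) slide_simps(3) slide_div)
  next
    case 4
    then have "p div 2 < q div 2" using pq by linarith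
    with 4 show thesis by (intro that(4) slide_simps(4))
  next
    case 5
    then show thesis by (intro that(5) slide_simps(5))
  qed
qed

text \<open>The five cases have disjoint ranges: 0, 1, the blocks 1 to \<open>p div 2\<close>, the
  point \<open>q\<close> in a higher block, and the other points of higher blocks. Ordering u and v
  by block saves half of the combinations.\<close>

lemma slide_inject:
  assumes uv: "slide X d p q u = slide X d p q v" "u div 2 \<le> v div 2"
  shows "u = v"
proof (cases u rule: slide_cases)
  case 1
  then show ?thesis using uv pq by (cases v rule: slide_cases) auto
next
  case 2
  then show ?thesis using uv pq by (cases v rule: slide_cases) auto
next
  case u: 3
  show ?thesis
  proof (cases v rule: slide_cases)
    case 3
    then show ?thesis using u uv by (metis shift_inject)
  qed (use u uv pq in linarith)+
next
  case u: 4
  show ?thesis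
  proof (cases v rule: slide_cases)
    case 4
    then show ?thesis using u pq by linarith
  qed (use u uv pq in linarith)+
next
  case 5
  then show ?thesis using uv pq by (cases v rule: slide_cases) auto
qed

lemma inj_slide: "inj (slide X d p q)"
  by (rule injI) (metis slide_inject nat_le_linear)

lemma slide_less:
  assumes "q < n" "u < n"
  shows "slide X d p q u < n"
proof (cases u rule: slide_cases)
  case 3
  then have "slide X d p q u div 2 \<le> p div 2" by simp
  with 3 show ?thesis using assms pq by linarith
qed (use assms pq in auto)

lemma slide_permutes: "q < n \<Longrightarrow> slide X d p q permutes {..<n}"
proof (rule bij_imp_permutes)
  assume q: "q < n"
  have "slide X d p q ` {..<n} = {..<n}"
    using slide_less[OF q] by (intro endo_inj_surj inj_on_subset[OF inj_slide]) auto
  then show "bij_betw (slide X d p q) {..<n} {..<n}"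
    by (simp add: bij_betw_def inj_on_subset[OF inj_slide])
  fix u assume "u \<notin> {..<n}"
  then have "n \<le> u" by simp
  with q pq show "slide X d p q u = u"
    by (cases u rule: slide_cases) auto
qed

end

text \<open>For pairs ordered only up to blocks: in the exchange argument a slide may reverse a pair
  that is a block. Then the order is immaterial, since no third element shares the block.\<close>

lemma slide_block:
  assumes "a \<noteq> b" "a div 2 \<le> b div 2" "u \<noteq> a" "u \<noteq> b"
  shows "u div 2 < a div 2 \<Longrightarrow> slide X d a b u = shift X (d \<and> a div 2 \<noteq> b div 2) u"
    and "u div 2 = a div 2 \<Longrightarrow> slide X d a b u = b"
    and "a div 2 < u div 2 \<Longrightarrow> slide X d a b u = u"
proof -
  consider "a < b" | "b < a" "a div 2 = b div 2"
    using assms by linarith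
  note c = this
  show "u div 2 < a div 2 \<Longrightarrow> slide X d a b u = shift X (d \<and> a div 2 \<noteq> b div 2) u"
    using c by cases (use assms slide_simps(3)[of a b u X d] slide_simps(3)[of b a u X d]
        in \<open>auto simp: slide_commute[of X d a b]\<close>)
  show "slide X d a b u = b" if "u div 2 = a div 2"
    using c
  proof cases
    case 2
    then show ?thesis using that assms by linarith
  qed (use assms slide_simps(4)[of a b u X d] that in auto)
  show "a div 2 < u div 2 \<Longrightarrow> slide X d a b u = u"
    using c by cases (use assms slide_simps(5)[of a b u X d] slide_simps(5)[of b a u X d]
        in \<open>auto simp: slide_commute[of X d a b]\<close>)
qed

text \<open>Both orders pass through the same two blocks, and flips of a two-element set commute.
  For the twists \<open>False\<close> and \<open>d\<close> this is the relation x_i y_{i+1} = y_i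
  x_{i+1}.\<close>

lemma shift_commute: "shift X t (shift X t' u) = shift X t' (shift X t u)"
proof -
  have "shift X t (shift X t' u) div 2 = shift X t' (shift X t u) div 2"
    by (simp add: shift_div)
  moreover have m: "shift X t u mod 2 = (if X (u div 2 + 1) \<noteq> t then 1 - u mod 2 else u mod 2)" for t u
    by (simp add: shift_def)
  have "shift X t (shift X t' u) mod 2 = shift X t' (shift X t u) mod 2"
    unfolding m[of _ "shift X _ u"] m[of _ u] shift_div by auto
  ultimately show ?thesis by (metis div_mult_mod_eq)
qed

lemma slide_exchange_aux:
  fixes X :: "nat \<Rightarrow> bool" and d :: bool
  assumes "p < q" "r < s" "p \<noteq> r" "p \<noteq> s" "q \<noteq> r" "q \<noteq> s" "p div 2 \<le> r div 2"
    and u: "u \<noteq> p" "u \<noteq> q" "u \<noteq> r" "u \<noteq> s"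
  defines "F \<equiv> slide X d p q" and "G \<equiv> slide X d r s"
  shows "slide X d (F r) (F s) (F u) = slide X d (G p) (G q) (G u)"
\<comment> \<open>If p and r form a block, F moves r to q and G moves p to s, so in both orders the
  next slide joins q and s. Neither original pair is a block, hence F and G have the same
  twist.\<close>
proof (cases "p div 2 = r div 2")
  case True
  then have pq: "p div 2 < q div 2" and rs: "r div 2 < s div 2"
    using assms(1-6) by linarith+
  then have "F r = q" "F s = s" "G p = s" "G q = q"
    unfolding F_def G_def using assms(1-6) True by (simp_all add: slide_simps)
  moreover have "F u = G u"
  proof (cases "u div 2 < p div 2")
    case True
    then show ?thesis
      unfolding F_def G_def using u pq rs \<open>p div 2 = r div 2\<close> assms(1,2) by (simp add: slide_simps)
  next
    case False
    with u True assms(3) have "p div 2 < u div 2" by linarith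
    then show ?thesis
      unfolding F_def G_def using u pq rs True assms(1,2) by (simp add: slide_simps)
  qed
  ultimately show ?thesis by (simp add: slide_commute[of X d s])
next
  case False
  \<comment> \<open>From here on F fixes r and s, while G raises the block of p by one.\<close>
  with assms have pr: "p div 2 < r div 2" by simp
  let ?t = "d \<and> r div 2 \<noteq> s div 2"
  have rs: "r div 2 \<le> s div 2" and pq: "p div 2 \<le> q div 2" using assms by linarith+
  have F: "F r = r" "F s = s"
    unfolding F_def using pr rs assms by (simp_all add: slide_simps)
  have Gp: "G p = shift X ?t p"
    unfolding G_def using pr assms by (simp add: slide_simps)
  then have Gp': "G p div 2 = p div 2 + 1" by (simp add: shift_div)
  have Gq: "G q div 2 = p div 2 + 1 \<and> q div 2 = p div 2 \<or> G q div 2 > p div 2 + 1 \<and> q div 2 > p div 2"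
  proof -
    consider "q div 2 < r div 2" | "q div 2 = r div 2" | "q div 2 > r div 2" by linarith
    then show ?thesis
    proof cases
      case 1
      then have "G q div 2 = q div 2 + 1"
        unfolding G_def using assms(2) by (intro slide_div)
      then show ?thesis using pq by linarith
    next
      case 2
      then have "G q = s" unfolding G_def using assms by (simp add: slide_simps)
      moreover have "s div 2 > q div 2" using 2 assms by linarith
      ultimately show ?thesis using 2 pr by linarith
    next
      case 3
      then have "G q = q" unfolding G_def using assms by (simp add: slide_simps)
      then show ?thesis using 3 pr by linarith
    qed
  qed
  have inj: "inj G" unfolding G_def using assms by (intro inj_slide)
  have H: "G p \<noteq> G q" "G p div 2 \<le> G q div 2" "G u \<noteq> G p" "G u \<noteq> G q"
    using Gp' Gq assms(1) u by (auto simp: inj_eq[OF inj])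
  \<comment> \<open>G preserves whether the pair {p, q} is a block, so its slide has the same twist
    before and after G.\<close>
  have t: "(d \<and> G p div 2 \<noteq> G q div 2) = (d \<and> p div 2 \<noteq> q div 2)"
    using Gp' Gq by linarith
  consider "u div 2 < p div 2" | "u div 2 = p div 2" | "p div 2 < u div 2" by linarith
  then show ?thesis
  proof cases
    case 1
    then have Fu: "F u = shift X (d \<and> p div 2 \<noteq> q div 2) u"
      unfolding F_def using assms by (simp add: slide_simps)
    have Gu: "G u = shift X ?t u"
      unfolding G_def using 1 pr assms by (simp add: slide_simps)
    have "F u div 2 < r div 2" using 1 pr by (simp add: Fu shift_div)
    moreover from this have "F u \<noteq> r" "F u \<noteq> s" using rs by auto
    ultimately have "slide X d r s (F u) = shift X ?t (F u)"
      using assms(2) by (simp add: slide_simps)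
    moreover have "G u div 2 < G p div 2" using 1 by (simp add: Gu Gp' shift_div)
    ultimately show ?thesis
      unfolding F slide_block(1)[OF H \<open>G u div 2 < G p div 2\<close>] t using Fu Gu by (simp add: shift_commute)
  next
    case 2
    then have Fu: "F u = q"
      unfolding F_def using assms by (simp add: slide_simps)
    have "G u div 2 = u div 2 + 1"
      unfolding G_def using 2 pr assms(2) by (intro slide_div) simp_all
    then have "G u div 2 = G p div 2" by (simp add: 2 Gp')
    from slide_block(2)[OF H this] show ?thesis
      unfolding F Fu by (simp add: G_def)
  next
    case 3
    then have Fu: "F u = u"
      unfolding F_def using assms by (simp add: slide_simps)
    have "G u div 2 > p div 2 + 1"
    proof -
      consider "u div 2 < r div 2" | "u div 2 = r div 2" | "u div 2 > r div 2" by linarith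
      then show ?thesis
      proof cases
        case 1
        then have "G u div 2 = u div 2 + 1"
          unfolding G_def using assms(2) by (intro slide_div)
        then show ?thesis using 3 by linarith
      next
        case 2
        then have "G u = s" unfolding G_def using assms by (simp add: slide_simps)
        moreover have "s div 2 > u div 2" using 2 assms by linarith
        ultimately show ?thesis using 2 pr by linarith
      next
        case 3
        then have "G u = u" unfolding G_def using assms by (simp add: slide_simps)
        then show ?thesis using 3 pr by linarith
      qed
    qed
    then have "G p div 2 < G u div 2" by (simp add: Gp')
    from slide_block(3)[OF H this] show ?thesis
      unfolding F Fu by (simp add: G_def)
  qed
qed

text \<open>The four joined points must be excluded: the pair joined first ends in block 1 and the
  other one in block 0, so on these points the two orders disagree.\<close>

lemma slide_exchange:
  assumes "p \<noteq> q" "r \<noteq> s" "{p, q} \<inter> {r, s} = {}" "u \<notin> {p, q, r, s}"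
  shows "slide X d (slide X d p q r) (slide X d p q s) (slide X d p q u) =
    slide X d (slide X d r s p) (slide X d r s q) (slide X d r s u)"
proof -
  have *: "slide X d (slide X d p q r) (slide X d p q s) (slide X d p q u) =
    slide X d (slide X d r s p) (slide X d r s q) (slide X d r s u)"
    if "p < q" "r < s" "{p, q} \<inter> {r, s} = {}" "u \<notin> {p, q, r, s}" for p q r s
  proof (cases "p div 2 \<le> r div 2")
    case True
    with that show ?thesis by (intro slide_exchange_aux) auto
  next
    case False
    with that show ?thesis by (intro slide_exchange_aux[symmetric]) auto
  qed
  consider "p < q" "r < s" | "q < p" "r < s" | "p < q" "s < r" | "q < p" "s < r"
    using assms(1,2) by linarith
  then show ?thesis
  proof cases
    case 1
    then show ?thesis using *[of p q r s] assms by auto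
  next
    case 2
    then show ?thesis
      using *[of q p r s] assms slide_commute[of X d q p] slide_commute[of X d "slide X d r s q"] by auto
  next
    case 3
    then show ?thesis
      using *[of p q s r] assms slide_commute[of X d s r] slide_commute[of X d "slide X d p q s"] by auto
  next
    case 4
    then show ?thesis
      using *[of q p s r] assms slide_commute[of X d q p] slide_commute[of X d s r]
        slide_commute[of X d "slide X d p q s"] slide_commute[of X d "slide X d r s q"] by auto
  qed
qed

section \<open>Multiplication by a generator\<close>

lemma div2_less_iff: "u div 2 < k \<longleftrightarrow> u < 2 * k" for u k :: nat
  using div_less_iff_less_mult[of 2 u k] by (simp add: mult.commute)

lemma block_less_iff: "u div 2 = v div 2 \<Longrightarrow> u < 2 * k \<longleftrightarrow> v < 2 * k" for u v k :: nat
  using div2_less_iff[of u k] div2_less_iff[of v k] by simp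

text \<open>Block 0 is singled out because a slide puts the pair that it joins there; the other
  blocks are dealt with by following the shift.\<close>

lemma block_cases:
  fixes a b k :: nat
  assumes "a = b \<or> a < 2 * k \<and> b < 2 * k \<and> a div 2 = b div 2"
  obtains "a = b" | "a < 2" "b < 2"
    | "2 \<le> a" "2 \<le> b" "a < 2 * k" "b < 2 * k" "a div 2 = b div 2"
proof (cases "a = b")
  case False
  with assms have ab: "a < 2 * k" "b < 2 * k" "a div 2 = b div 2" by simp_all
  with block_less_iff[of a b 1] have "a < 2 \<longleftrightarrow> b < 2" by simp
  with ab that(2,3) show thesis by (meson not_less)
qed (rule that(1))

context
  fixes X :: "nat \<Rightarrow> bool" and d :: bool and p q k :: nat
  assumes pq: "2 * k \<le> p" "p < q"
begin

lemma slide_low: "u < 2 * k \<Longrightarrow> slide X d p q u div 2 = u div 2 + 1"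
  using pq div2_less_iff[of u k] div2_less_iff[of p k] by (intro slide_div) linarith+

lemma slide_high:
  assumes "\<not> u < 2 * k" "u \<noteq> p" "u \<noteq> q"
  shows "2 * (k + 1) \<le> slide X d p q u"
proof (cases rule: slide_cases[OF pq(2), where u = u and X = X and d = d])
  case 3
  with assms pq(1) show ?thesis
    using div2_less_iff[of u k] div2_less_iff[of "slide X d p q u" "k + 1"] by linarith
next
  case 4
  with assms pq(1) show ?thesis
    using div2_less_iff[of u k] div2_less_iff[of q "k + 1"] by linarith
next
  case 5
  with assms pq(1) show ?thesis
    using div2_less_iff[of p k] div2_less_iff[of u "k + 1"] by linarith
qed (use assms in auto)

lemma slide_low_bounds:
  assumes "u < 2 * k"
  shows "2 \<le> slide X d p q u" "slide X d p q u < 2 * (k + 1)"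
  using slide_low[OF assms] assms div2_less_iff[of u k]
    div2_less_iff[of "slide X d p q u" "k + 1"] div2_less_iff[of "slide X d p q u" 1]
  by linarith+

end

lemma canon_mult_slide:
  fixes X :: "nat \<Rightarrow> bool" and d :: bool
  assumes f: "f permutes {..<n}" and pq: "2 * k \<le> p" "p < q" "q < n"
  defines "h \<equiv> slide X d p q"
  shows "brauer_mult (canon n k f) (canon n 1 h) = canon n (k + 1) (h \<circ> f)"
proof -
  have f': "f u < n" if "u < n" for u
    using permutes_in_image[OF f, of u] that by simp
  have h: "h permutes {..<n}" unfolding h_def using pq by (intro slide_permutes)
  have A: "h u div 2 = u div 2 + 1" if "u < 2 * k" for u
    unfolding h_def using pq(1,2) that by (rule slide_low)
  have A': "2 \<le> h u" "h u < 2 * (k + 1)" if "u < 2 * k" for u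
    unfolding h_def using slide_low_bounds[OF pq(1,2) that] by auto
  have hpq: "h p = 0" "h q = 1"
    unfolding h_def using pq by (simp_all add: slide_simps)
  have B: "2 * (k + 1) \<le> h u" if "\<not> u < 2 * k" "u \<noteq> p" "u \<noteq> q" for u
    unfolding h_def using pq(1,2) that by (rule slide_high)
  have lt2: "u \<in> {p, q}" if "h u < 2" for u
    using A'(1)[of u] B[of u] that by (cases "u < 2 * k") auto
  have ge2: "u < 2 * k" if "2 \<le> h u" "h u < 2 * (k + 1)" for u
  proof (rule ccontr)
    assume "\<not> u < 2 * k"
    with B[of u] that have "u = p \<or> u = q" by linarith
    with that hpq show False by auto
  qed
  have ge: "\<not> u < 2 * k" if "\<not> h u < 2 * (k + 1)" for u
    using A'(2)[of u] that by auto
  have surj: "\<exists>u<n. h u = v" if "v < n" for v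
    using permutes_image[OF h] that by (metis image_iff lessThan_iff)
  have inj: "h u = h v \<longleftrightarrow> u = v" "f u = f v \<longleftrightarrow> u = v" for u v
    using permutes_inj[OF h] permutes_inj[OF f] by (auto simp: inj_eq)
  define conn where "conn = (adjacent (canon n k f) (canon n 1 h))\<^sup>*"
  note E = canon_mult_edges[where n = n and k = k and f = f and m = 1 and h = h, folded conn_def]
  have S: "(y, x) \<in> conn" if "(x, y) \<in> conn" for x y
    using that sym_rtrancl_adjacent unfolding conn_def by (rule symD[rotated])
  have T: "(x, z) \<in> conn" if "(x, y) \<in> conn" "(y, z) \<in> conn" for x y z
    using that unfolding conn_def by (rule rtrancl_trans)
  have R: "(x, x) \<in> conn" for x unfolding conn_def by simp
  show ?thesis
  \<comment> \<open>Middle pins below \<open>2 * k\<close> are joined among themselves by the left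
    factor, so their components end on the right and take right codes. Every other middle pin is
    joined to a left pin and takes a left code.\<close>
  proof (rule canon_mult[where n = n and k = k and f = f and m = 1 and h = h and g = "\<lambda>v. if v < 2 * k then rcode (k + 1) (h v) else lcode (k + 1) (h v)",
        folded conn_def])
    fix u v assume uv: "u < n" "v < n"
    show "lcode (k + 1) ((h \<circ> f) u) = lcode (k + 1) ((h \<circ> f) v)" if "lcode k (f u) = lcode k (f v)"
      using that A A' unfolding code_eq_iff by auto
    show "lcode (k + 1) ((h \<circ> f) u) = (if v < 2 * k then rcode (k + 1) (h v) else lcode (k + 1) (h v))"
      if "lcode k (f u) = rcode k v"
      using that unfolding code_eq_iff by auto
    show "(if u < 2 * k then rcode (k + 1) (h u) else lcode (k + 1) (h u)) =
        (if v < 2 * k then rcode (k + 1) (h v) else lcode (k + 1) (h v))"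
      if "rcode k u = rcode k v"
      using that A A'[of u] A'[of v] unfolding code_eq_iff by (auto simp: code_eq_iff)
    show "(if u < 2 * k then rcode (k + 1) (h u) else lcode (k + 1) (h u)) =
        (if v < 2 * k then rcode (k + 1) (h v) else lcode (k + 1) (h v))"
      if "lcode 1 (h u) = lcode 1 (h v)"
      using that lt2[of u] lt2[of v] pq hpq unfolding code_eq_iff inj by (auto simp: code_eq_iff)
    show "(if u < 2 * k then rcode (k + 1) (h u) else lcode (k + 1) (h u)) = rcode (k + 1) v"
      if "lcode 1 (h u) = rcode 1 v"
    proof (cases "u < 2 * k")
      case False
      with ge2 that have "\<not> v < 2 * (k + 1)" "h u = v" unfolding code_eq_iff by auto
      with False show ?thesis by (auto simp: code_eq_iff)
    qed (use that in \<open>simp add: code_eq_iff\<close>)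
    show "rcode (k + 1) u = rcode (k + 1) v" if "rcode 1 u = rcode 1 v"
      using that unfolding code_eq_iff by auto
    show "(Outer (Lpin (n - u)), Outer (Lpin (n - v))) \<in> conn"
      if "lcode (k + 1) ((h \<circ> f) u) = lcode (k + 1) ((h \<circ> f) v)"
    proof -
      have hf: "h (f u) = h (f v) \<or> h (f u) < 2 * (k + 1) \<and> h (f v) < 2 * (k + 1) \<and> h (f u) div 2 = h (f v) div 2"
        using that unfolding code_eq_iff o_apply .
      show ?thesis
        using hf
      proof (cases rule: block_cases)
        \<comment> \<open>Block 0: both left pins run to p or q and are joined by the block {p, q}
          of the generator.\<close>
        case 2
        then have "\<not> f u < 2 * k" "\<not> f v < 2 * k" using lt2 pq by force+
        then have "(Outer (Lpin (n - u)), Mid (n - f u)) \<in> conn" "(Outer (Lpin (n - v)), Mid (n - f v)) \<in> conn"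
          using uv f' by (auto intro!: E(2) simp: code_eq_iff)
        moreover have "(Mid (n - f u), Mid (n - f v)) \<in> conn"
          using 2 uv f' by (intro E(4)) (auto simp: code_eq_iff)
        ultimately show ?thesis by (metis S T)
      next
        case 3
        then have "f u < 2 * k" "f v < 2 * k" using ge2 by blast+
        with 3 A have "lcode k (f u) = lcode k (f v)" by (simp add: code_eq_iff)
        with uv show ?thesis by (rule E(1))
      qed (simp add: R inj)
    qed
    show "(Outer (Lpin (n - u)), Outer (Rpin (n - v))) \<in> conn"
      if "lcode (k + 1) ((h \<circ> f) u) = rcode (k + 1) v"
    proof (rule T)
      have v: "v = h (f u)" "\<not> h (f u) < 2 * (k + 1)" using that by (auto simp: code_eq_iff)
      show "(Outer (Lpin (n - u)), Mid (n - f u)) \<in> conn"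
        using ge[OF v(2)] uv f' by (intro E(2)) (auto simp: code_eq_iff)
      show "(Mid (n - f u), Outer (Rpin (n - v))) \<in> conn"
        using v uv f' by (intro E(5)) (auto simp: code_eq_iff)
    qed
    show "(Outer (Rpin (n - u)), Outer (Rpin (n - v))) \<in> conn" if "rcode (k + 1) u = rcode (k + 1) v"
    proof -
      show ?thesis
        using that[unfolded code_eq_iff]
      proof (cases rule: block_cases)
        case 2
        then show ?thesis using uv by (intro E(6)) (auto simp: code_eq_iff)
      next
        case 3
        \<comment> \<open>A raised block of right pins: its preimage is a block that the left factor
          joins.\<close>
        obtain u' v' where uv': "u' < n" "v' < n" "u = h u'" "v = h v'"
          using surj uv by metis
        with 3 have "u' < 2 * k" "v' < 2 * k" using ge2 by blast+
        with 3 A uv' have "(Mid (n - u'), Mid (n - v')) \<in> conn"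
          by (intro E(3)) (auto simp: code_eq_iff)
        moreover have "(Mid (n - u'), Outer (Rpin (n - u))) \<in> conn" "(Mid (n - v'), Outer (Rpin (n - v))) \<in> conn"
          using 3 uv uv' by (auto intro!: E(5) simp: code_eq_iff)
        ultimately show ?thesis by (metis S T)
      qed (simp add: R)
    qed
  qed
qed

text \<open>The block of p is joined by \<open>canon n k f\<close>. A line arriving at q continues
  to p, to the second element of the block of p, and by the slide to the right pin q, so it is
  restored. If q is in the block of p, a closed loop is discarded. Lower blocks move up by one and
  the generator fills block 0, so the first k blocks of right pins are joined again.\<close>

lemma canon_mult_absorb:
  fixes X :: "nat \<Rightarrow> bool" and d :: bool
  assumes f: "f permutes {..<n}" and pq: "p < 2 * k" "p < q" "q < n" and k: "2 * k \<le> n"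
  defines "h \<equiv> slide X d p q"
  shows "brauer_mult (canon n k f) (canon n 1 h) = canon n k f"
proof -
  have f': "f u < n" if "u < n" for u
    using permutes_in_image[OF f, of u] that by simp
  have h: "h permutes {..<n}" unfolding h_def using pq by (intro slide_permutes)
  have hpq: "h p = 0" "h q = 1"
    unfolding h_def using pq by (simp_all add: slide_simps)
  have lt2: "u \<in> {p, q}" if "h u < 2" for u
  proof (cases rule: slide_cases[OF pq(2), where u = u and X = X and d = d])
    case 3
    with that show ?thesis unfolding h_def by linarith
  next
    case 4
    with that show ?thesis unfolding h_def by linarith
  next
    case 5
    with that show ?thesis unfolding h_def by linarith
  qed auto
  have low: "h u div 2 = u div 2 + 1" if "u div 2 < p div 2" for u
    unfolding h_def using pq(2) that by (rule slide_div)
  have mate: "h u = q" if "u \<noteq> p" "u \<noteq> q" "u div 2 = p div 2" for u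
    unfolding h_def using pq(2) that by (rule slide_simps(4))
  have high: "h u = u" if "u \<noteq> q" "p div 2 < u div 2" for u
    unfolding h_def using pq(2) that by (intro slide_simps(5)) auto
  have surj: "\<exists>u<n. h u = v" if "v < n" for v
    using permutes_image[OF h] that by (metis image_iff lessThan_iff)
  have inj: "h u = h v \<longleftrightarrow> u = v" "f u = f v \<longleftrightarrow> u = v" for u v
    using permutes_inj[OF h] permutes_inj[OF f] by (auto simp: inj_eq)
  define conn where "conn = (adjacent (canon n k f) (canon n 1 h))\<^sup>*"
  note E = canon_mult_edges[where n = n and k = k and f = f and m = 1 and h = h, folded conn_def]
  have S: "(y, x) \<in> conn" if "(x, y) \<in> conn" for x y
    using that sym_rtrancl_adjacent unfolding conn_def by (rule symD[rotated])
  have T: "(x, z) \<in> conn" if "(x, y) \<in> conn" "(y, z) \<in> conn" for x y z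
    using that unfolding conn_def by (rule rtrancl_trans)
  have R: "(x, x) \<in> conn" for x unfolding conn_def by simp
  \<comment> \<open>The block of p is labelled like q, to which it is connected, and each lower
    block like the block above it. If q lies in the block of p, this block is a closed loop, where
    any common label would do.\<close>
  define g where "g = (\<lambda>v. if v div 2 = p div 2 then rcode k q
    else if v div 2 < p div 2 then (1, v div 2 + 1) else rcode k v)"
  have g_block: "g u = g v" if "u < 2 * k" "v < 2 * k" "u div 2 = v div 2" for u v
    unfolding g_def using that by (auto simp: code_eq_iff)
  have g_ge: "g v = (2, v)" if "\<not> v < 2 * k" for v
    unfolding g_def using that pq(1) block_less_iff[of v p k] by (auto simp: rcode_def)
  have gpq: "g p = g q"
    unfolding g_def using pq(2) by (auto simp: div_le_mono not_less)
  have g_h: "g u = rcode k (h u)" if "\<not> h u < 2" for u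
  proof -
    have "u \<noteq> p" "u \<noteq> q" using that hpq by auto
    then consider "u div 2 < p div 2" | "h u = q" "u div 2 = p div 2" | "h u = u" "p div 2 < u div 2"
      using mate[of u] high[of u] by linarith
    then show ?thesis
    proof cases
      case 1
      with low[of u] pq(1) have "h u < 2 * k"
        using div2_less_iff[of p k] div2_less_iff[of "h u" k] by linarith
      with 1 low[of u] show ?thesis by (simp add: g_def rcode_def)
    qed (auto simp: g_def)
  qed
  have direct: "(Mid (n - w), Outer (Rpin (n - w))) \<in> conn" if "w < n" "w \<noteq> q" "p div 2 < w div 2" for w
    using that high[of w] by (intro E(5)) (auto simp: code_eq_iff)
  have detour: "\<exists>w<n. w div 2 = p div 2 \<and> (Mid (n - w), Outer (Rpin (n - q))) \<in> conn \<and> (Mid (n - p), Mid (n - w)) \<in> conn"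
    if "p div 2 < q div 2"
  proof -
    \<comment> \<open>the second element of the block of \<open>p\<close>\<close>
    define w where "w = (if even p then p + 1 else p - 1)"
    have w: "w \<noteq> p" "w div 2 = p div 2" unfolding w_def by (auto elim: oddE evenE)
    then have "w < q" "w < 2 * k" using that pq(1) block_less_iff[of w p k] by linarith+
    with w mate[of w] pq k have "(Mid (n - w), Outer (Rpin (n - q))) \<in> conn"
      by (intro E(5)) (auto simp: code_eq_iff)
    moreover have "(Mid (n - p), Mid (n - w)) \<in> conn"
      using w pq \<open>w < q\<close> \<open>w < 2 * k\<close> by (intro E(3)) (auto simp: code_eq_iff)
    ultimately show ?thesis using w \<open>w < q\<close> pq(3) by (meson less_trans)
  qed
  have via: "(Mid (n - q), Outer (Rpin (n - q))) \<in> conn" if "p div 2 < q div 2"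
  proof -
    \<comment> \<open>The generator joins q to p, the left factor joins p to the second element of
      its block, and the slide sends that element to the right pin q.\<close>
    have "(Mid (n - p), Mid (n - q)) \<in> conn"
      using pq hpq by (intro E(4)) (auto simp: code_eq_iff)
    with detour[OF that] show ?thesis by (metis S T)
  qed
  have straight: "(Mid (n - w), Outer (Rpin (n - w))) \<in> conn" if "w < n" "p div 2 < w div 2" for w
    using direct[of w] via that by (cases "w = q") auto
  show ?thesis
  proof (rule canon_mult[where n = n and k = k and f = f and m = 1 and h = h and g = g, folded conn_def])
    fix u v assume uv: "u < n" "v < n"
    show "lcode k (f u) = lcode k (f v)" if "lcode k (f u) = lcode k (f v)"
      using that .
    show "lcode k (f u) = g v" if "lcode k (f u) = rcode k v"
      using that g_ge[of v] unfolding code_eq_iff by (auto simp: lcode_def)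
    show "g u = g v" if "rcode k u = rcode k v"
      using that g_block unfolding code_eq_iff by auto
    show "g u = g v" if "lcode 1 (h u) = lcode 1 (h v)"
      using that lt2[of u] lt2[of v] gpq unfolding code_eq_iff inj by auto
    show "g u = rcode k v" if "lcode 1 (h u) = rcode 1 v"
      using that g_h[of u] unfolding code_eq_iff by auto
    show "rcode k u = rcode k v" if "rcode 1 u = rcode 1 v"
    proof -
      have "2 \<le> 2 * k" using pq(1) by simp
      with that show ?thesis unfolding code_eq_iff by auto
    qed
    show "(Outer (Lpin (n - u)), Outer (Lpin (n - v))) \<in> conn" if "lcode k (f u) = lcode k (f v)"
      using uv that by (rule E(1))
    show "(Outer (Lpin (n - u)), Outer (Rpin (n - v))) \<in> conn" if "lcode k (f u) = rcode k v"
    proof (rule T)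
      show "(Outer (Lpin (n - u)), Mid (n - v)) \<in> conn" using uv that by (rule E(2))
      have "\<not> v < 2 * k" using that by (simp add: code_eq_iff)
      then show "(Mid (n - v), Outer (Rpin (n - v))) \<in> conn"
        using pq(1) uv div2_less_iff[of p k] div2_less_iff[of v k] by (intro straight) linarith+
    qed
    show "(Outer (Rpin (n - u)), Outer (Rpin (n - v))) \<in> conn" if "rcode k u = rcode k v"
    proof -
      show ?thesis
        using that[unfolded code_eq_iff]
      proof (cases rule: block_cases)
        case 2
        then show ?thesis using uv by (intro E(6)) (auto simp: code_eq_iff)
      next
        case 3
        have M: "(Mid (n - u'), Mid (n - v')) \<in> conn" if "u' < n" "v' < n" "u' < 2 * k" "v' < 2 * k" "u' div 2 = v' div 2" for u' v'
          using that by (intro E(3)) (auto simp: code_eq_iff)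
        show ?thesis
        proof (cases "p div 2 < u div 2")
          case True
          with 3 uv straight M show ?thesis by (metis S T)
        next
          \<comment> \<open>On the right, the blocks 1 to \<open>p div 2\<close> are images of
            blocks below that of p, which the left factor joins.\<close>
          case False
          obtain u' v' where uv': "u' < n" "v' < n" "u = h u'" "v = h v'"
            using surj uv by metis
          have lo: "w div 2 < p div 2" if "2 \<le> h w" "h w div 2 \<le> p div 2" for w
          proof (rule ccontr)
            assume w: "\<not> w div 2 < p div 2"
            have "w \<noteq> p" "w \<noteq> q" using that hpq by auto
            with w mate[of w] high[of w] that show False
              using pq(2) by linarith
          qed
          have "u' div 2 < p div 2" "v' div 2 < p div 2" using lo uv' 3 False by auto
          with low uv' 3 pq(1) have "u' div 2 = v' div 2" "u' < 2 * k" "v' < 2 * k" by auto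
          moreover have "(Mid (n - u'), Outer (Rpin (n - u))) \<in> conn" "(Mid (n - v'), Outer (Rpin (n - v))) \<in> conn"
            using 3 uv uv' by (auto intro!: E(5) simp: code_eq_iff)
          ultimately show ?thesis using M uv' by (metis S T)
        qed
      qed (simp add: R)
    qed
  qed
qed

section \<open>Products of generators and matchings\<close>

text \<open>Only factors that raise the corank are recorded. The others are absorbed, so no product
  is lost.\<close>

inductive reach :: "(nat \<Rightarrow> bool) \<Rightarrow> bool \<Rightarrow> nat \<Rightarrow> nat \<Rightarrow> (nat \<Rightarrow> nat) \<Rightarrow> bool"
  for X :: "nat \<Rightarrow> bool" and d :: bool and n :: nat where
  reach_0: "reach X d n 0 id"
| reach_Suc: "reach X d n k f \<Longrightarrow> 2 * k \<le> p \<Longrightarrow> p < q \<Longrightarrow> q < n \<Longrightarrow>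
    reach X d n (k + 1) (slide X d p q \<circ> f)"

lemma reach_permutes: "reach X d n k f \<Longrightarrow> f permutes {..<n}"
  by (induction rule: reach.induct) (blast intro: permutes_id permutes_compose slide_permutes)+

lemma reach_le: "reach X d n k f \<Longrightarrow> 2 * k \<le> n"
  by (induction rule: reach.induct) auto

lemma permutes_less: "f permutes {..<n} \<Longrightarrow> f u < n \<longleftrightarrow> u < n" for n :: nat
  using permutes_in_image[of f "{..<n}" u] by simp

lemma permutes_eq_iff: "f permutes S \<Longrightarrow> f u = f v \<longleftrightarrow> u = v"
  by (simp add: permutes_inj inj_eq)

lemma permutes_surj_less:
  fixes n :: nat
  assumes "f permutes {..<n}" "v < n"
  obtains u where "u < n" "f u = v"
  using permutes_surj[OF assms(1)] permutes_less[OF assms(1)] assms(2) by (metis surjD)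

lemma reach_extend:
  assumes f: "reach X d n k f" and "a < n" "b < n" "a \<noteq> b" "\<not> f a < 2 * k" "\<not> f b < 2 * k"
  shows "reach X d n (k + 1) (slide X d (f a) (f b) \<circ> f)"
proof -
  have "f a < n" "f b < n" "f a \<noteq> f b"
    using assms permutes_less[OF reach_permutes[OF f]] permutes_eq_iff[OF reach_permutes[OF f]] by auto
  then consider "f a < f b" | "f b < f a" by linarith
  then show ?thesis
  proof cases
    case 1
    with assms \<open>f b < n\<close> show ?thesis by (intro reach_Suc) auto
  next
    case 2
    with assms \<open>f a < n\<close> show ?thesis
      unfolding slide_commute[of X d "f a"] by (intro reach_Suc) auto
  qed
qed

text \<open>In coordinates, the left blocks of \<open>canon n k f\<close>, that is, the data of its
  R-class.\<close>

definition matching :: "nat \<Rightarrow> nat \<Rightarrow> (nat \<Rightarrow> nat) \<Rightarrow> nat set set" where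
  "matching n k f =
    {{u, v} | u v. u < n \<and> v < n \<and> u \<noteq> v \<and> f u < 2 * k \<and> f u div 2 = f v div 2}"

lemma mem_matching:
  "{u, v} \<in> matching n k f \<longleftrightarrow> u < n \<and> v < n \<and> u \<noteq> v \<and> f u < 2 * k \<and> f u div 2 = f v div 2"
  using block_less_iff[of "f u" "f v" k] unfolding matching_def by (auto simp: doubleton_eq_iff)

definition mate :: "nat \<Rightarrow> nat" where
  "mate u = (if even u then u + 1 else u - 1)"

lemma mate: "mate u div 2 = u div 2" "mate u \<noteq> u"
  unfolding mate_def by (auto elim: oddE evenE)

lemma mate_unique: "v div 2 = u div 2 \<Longrightarrow> v \<noteq> u \<Longrightarrow> v = mate u"
  using mate[of u] by linarith

lemma Union_matching:
  assumes f: "f permutes {..<n}" and k: "2 * k \<le> n"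
  shows "\<Union> (matching n k f) = {u. u < n \<and> f u < 2 * k}"
proof
  show "\<Union> (matching n k f) \<subseteq> {u. u < n \<and> f u < 2 * k}"
    unfolding matching_def using block_less_iff by blast
  show "{u. u < n \<and> f u < 2 * k} \<subseteq> \<Union> (matching n k f)"
  proof
    fix u assume "u \<in> {u. u < n \<and> f u < 2 * k}"
    then have u: "u < n" "f u < 2 * k" by auto
    have "mate (f u) < 2 * k" using block_less_iff[OF mate(1)] u by simp
    with k have "mate (f u) < n" by simp
    with f obtain v where v: "v < n" "f v = mate (f u)" by (rule permutes_surj_less)
    with mate[of "f u"] u have "{u, v} \<in> matching n k f"
      unfolding mem_matching by metis
    then show "u \<in> \<Union> (matching n k f)" by blast
  qed
qed

lemma card_Union_matching:
  assumes f: "f permutes {..<n}" and k: "2 * k \<le> n"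
  shows "card (\<Union> (matching n k f)) = 2 * k"
proof -
  have "f ` {u. u < n \<and> f u < 2 * k} = {..<2 * k}"
  proof
    show "{..<2 * k} \<subseteq> f ` {u. u < n \<and> f u < 2 * k}"
    proof
      fix v assume "v \<in> {..<2 * k}"
      with k have "v < n" "v < 2 * k" by auto
      with f obtain u where "u < n" "f u = v" by (metis permutes_surj_less)
      with \<open>v < 2 * k\<close> show "v \<in> f ` {u. u < n \<and> f u < 2 * k}" by blast
    qed
  qed auto
  then have "card {u. u < n \<and> f u < 2 * k} = card {..<2 * k}"
    by (metis card_image inj_on_subset permutes_inj[OF f] subset_UNIV)
  then show ?thesis by (simp add: Union_matching[OF f k])
qed

text \<open>The slide raises the old blocks by one, puts the new pair in block 0 and keeps every
  other value outside the first k+1 blocks.\<close>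

lemma matching_extend:
  assumes f: "f permutes {..<n}" and ab: "a < n" "b < n" "a \<noteq> b" "\<not> f a < 2 * k" "\<not> f b < 2 * k"
  shows "matching n (k + 1) (slide X d (f a) (f b) \<circ> f) = insert {a, b} (matching n k f)"
proof -
  \<comment> \<open>The values p < q are ordered, but a and b need not be in the corresponding
    order; hence the names \<open>a'\<close> and \<open>b'\<close>.\<close>
  have *: "matching n (k + 1) (slide X d p q \<circ> f) = insert {a, b} (matching n k f)"
    if pq: "2 * k \<le> p" "p < q" and ab': "{a, b} = {a', b'}" "p = f a'" "q = f b'" for p q a' b'
  proof -
    let ?h = "slide X d p q"
    have ab'': "a' < n" "b' < n" using ab' ab by (auto simp: doubleton_eq_iff)
    have hpq: "?h p = 0" "?h q = 1" using pq(2) by (simp_all add: slide_simps)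
    have "{u, v} \<in> matching n (k + 1) (?h \<circ> f) \<longleftrightarrow> {u, v} \<in> insert {a', b'} (matching n k f)" for u v
    proof -
      have eq: "w = a' \<longleftrightarrow> f w = p" "w = b' \<longleftrightarrow> f w = q" for w
        using permutes_eq_iff[OF f] ab' by auto
      have low: "?h w div 2 = w div 2 + 1" if "w < 2 * k" for w using pq that by (rule slide_low)
      have low': "?h w < 2 * (k + 1)" if "w < 2 * k" for w using pq that by (rule slide_low_bounds)
      have high: "2 * (k + 1) \<le> ?h w" if "\<not> w < 2 * k" "w \<noteq> p" "w \<noteq> q" for w
        using pq that by (rule slide_high)
      consider "f u < 2 * k" | "f u = p \<or> f u = q" | "\<not> f u < 2 * k" "f u \<noteq> p" "f u \<noteq> q" by blast
      then show ?thesis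
      proof cases
        case 1
        then have "f u \<noteq> p" "f u \<noteq> q" using pq by auto
        then have "{u, v} \<noteq> {a', b'}" using eq by (auto simp: doubleton_eq_iff)
        moreover have "?h (f u) div 2 = ?h (f v) div 2 \<longleftrightarrow> f u div 2 = f v div 2"
        proof (cases "f v < 2 * k")
          case True
          then show ?thesis using low 1 by simp
        next
          case False
          with 1 have "f u div 2 \<noteq> f v div 2" using block_less_iff by blast
          moreover have "?h (f u) div 2 \<noteq> ?h (f v) div 2"
          proof
            assume eq: "?h (f u) div 2 = ?h (f v) div 2"
            then have "?h (f v) < 2 * (k + 1)" using low'[OF 1] block_less_iff by blast
            with high[of "f v"] False have "f v = p \<or> f v = q" by linarith
            with hpq have "?h (f v) div 2 = 0" by auto
            with eq low[OF 1] show False by simp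
          qed
          ultimately show ?thesis by simp
        qed
        ultimately show ?thesis using 1 low'[OF 1] unfolding insert_iff mem_matching by auto
      next
        case 2
        then have h0: "?h (f u) div 2 = 0" "?h (f u) < 2 * (k + 1)" using hpq by auto
        have "\<not> f u < 2 * k" using 2 pq by auto
        then have "{u, v} \<notin> matching n k f" unfolding mem_matching by blast
        moreover have "?h (f v) div 2 = 0 \<longleftrightarrow> f v = p \<or> f v = q"
        proof
          assume z: "?h (f v) div 2 = 0"
          then have "\<not> f v < 2 * k" using low[of "f v"] by auto
          moreover have "\<not> 2 * (k + 1) \<le> ?h (f v)"
            using z by (simp add: div_eq_0_iff)
          ultimately show "f v = p \<or> f v = q" using high by blast
        qed (use hpq in auto)
        moreover have "{u, v} = {a', b'} \<longleftrightarrow> (f v = p \<or> f v = q) \<and> u \<noteq> v"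
          using 2 eq pq(2) permutes_eq_iff[OF f, of u v] by (auto simp: doubleton_eq_iff)
        moreover have "u < n" "v < n" if "{u, v} = {a', b'}"
          using that ab'' by (auto simp: doubleton_eq_iff)
        moreover have "u < n" using 2 eq ab'' by metis
        moreover have "v < n" if "f v = p \<or> f v = q" using that eq ab'' by metis
        ultimately show ?thesis using h0 unfolding insert_iff mem_matching by auto
      next
        case 3
        then have "{u, v} \<noteq> {a', b'}" using eq by (auto simp: doubleton_eq_iff)
        moreover have "\<not> ?h (f u) < 2 * (k + 1)" using high[OF 3] by simp
        ultimately show ?thesis using 3 unfolding insert_iff mem_matching by simp
      qed
    qed
    moreover have "\<exists>u v. S = {u, v}" if "S \<in> matching n (k + 1) (?h \<circ> f) \<or> S \<in> insert {a', b'} (matching n k f)" for S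
      using that unfolding matching_def by auto
    ultimately show ?thesis unfolding ab'(1) by (intro set_eqI) metis
  qed
  have "f a \<noteq> f b" using permutes_eq_iff[OF f] ab by simp
  then consider "f a < f b" | "f b < f a" by linarith
  then show ?thesis
  proof cases
    case 1
    then show ?thesis using ab by (intro *) auto
  next
    case 2
    then show ?thesis unfolding slide_commute[of X d "f a"] using ab by (intro *) auto
  qed
qed

lemma matching_doubleton: "S \<in> matching n k f \<Longrightarrow> \<exists>u v. S = {u, v} \<and> u < n \<and> v < n \<and> u \<noteq> v"
  unfolding matching_def by blast

lemma matching_disjoint:
  assumes "f permutes {..<n}" "S \<in> matching n k f" "T \<in> matching n k f" "S \<noteq> T"
  shows "S \<inter> T = {}"
proof (rule ccontr)
  assume "S \<inter> T \<noteq> {}"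
  then obtain u where u: "u \<in> S" "u \<in> T" by blast
  have *: "\<exists>v. R = {u, v}" if "R \<in> matching n k f" "u \<in> R" for R
  proof -
    obtain a b where "R = {a, b}" using matching_doubleton \<open>R \<in> matching n k f\<close> by metis
    with \<open>u \<in> R\<close> have "R = {u, if u = a then b else a}" by auto
    then show ?thesis ..
  qed
  obtain v w where vw: "S = {u, v}" "T = {u, w}" using * assms(2,3) u by metis
  then have "f v div 2 = f u div 2" "f v \<noteq> f u" "f w div 2 = f u div 2" "f w \<noteq> f u"
    using assms(2,3) unfolding mem_matching vw by (auto simp: permutes_eq_iff[OF assms(1)])
  then have "f v = f w" using mate_unique by metis
  then show False using assms(4) vw permutes_eq_iff[OF assms(1)] by simp
qed

text \<open>Pairs can be added in any order: one that is disjoint from the current matching has both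
  values outside the first k blocks, as \<open>reach_extend\<close> requires. Besides meeting every
  R-class, this supplies the auxiliary product in the uniqueness proof.\<close>

lemma reach_matching_exists:
  assumes "finite E" "\<forall>S\<in>E. \<exists>u v. S = {u, v} \<and> u < n \<and> v < n \<and> u \<noteq> v"
    and "\<forall>S\<in>E. \<forall>T\<in>E. S \<noteq> T \<longrightarrow> S \<inter> T = {}"
  shows "\<exists>k f. reach X d n k f \<and> matching n k f = E"
  using assms
proof (induction rule: finite_induct)
  case empty
  have "matching n 0 id = {}" unfolding matching_def by auto
  then show ?case using reach_0 by blast
next
  case (insert S E)
  then obtain k f where kf: "reach X d n k f" "matching n k f = E" by auto
  obtain a b where ab: "S = {a, b}" "a < n" "b < n" "a \<noteq> b" using insert.prems by auto
  have f: "f permutes {..<n}" "2 * k \<le> n" using kf reach_permutes reach_le by auto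
  have "S \<inter> T = {}" if "T \<in> E" for T
    using insert.prems(2) insert.hyps(2) that by (metis insertCI)
  then have "a \<notin> \<Union> (matching n k f)" "b \<notin> \<Union> (matching n k f)"
    unfolding kf(2) ab(1) by blast+
  then have "\<not> f a < 2 * k" "\<not> f b < 2 * k"
    unfolding Union_matching[OF f] using ab by simp_all
  then have "reach X d n (k + 1) (slide X d (f a) (f b) \<circ> f)"
    "matching n (k + 1) (slide X d (f a) (f b) \<circ> f) = insert S E"
    using reach_extend[OF kf(1)] matching_extend[OF f(1)] ab kf(2) by simp_all
  then show ?case by blast
qed

text \<open>Pulls the last slide back to the original coordinates of the pair that it joins, so that
  the last pairs of two products can be compared.\<close>

lemma reach_SucE:
  assumes "reach X d n (Suc k) f"
  obtains f' a b where "reach X d n k f'" "f = slide X d (f' a) (f' b) \<circ> f'" "a < n" "b < n" "a \<noteq> b"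
    "\<not> f' a < 2 * k" "\<not> f' b < 2 * k" "matching n (Suc k) f = insert {a, b} (matching n k f')"
    "{a, b} \<notin> matching n k f'"
  using assms
proof cases
  case (reach_Suc k' f' p q)
  then have f': "f' permutes {..<n}" by (simp add: reach_permutes)
  from reach_Suc have "p < n" "q < n" by auto
  with f' obtain a b where ab: "a < n" "f' a = p" "b < n" "f' b = q" by (metis permutes_surj_less)
  have "matching n (k + 1) (slide X d (f' a) (f' b) \<circ> f') = insert {a, b} (matching n k f')"
    using ab reach_Suc by (intro matching_extend f') auto
  moreover have "{a, b} \<notin> matching n k f'" using ab reach_Suc by (auto simp: mem_matching)
  ultimately show thesis using reach_Suc ab by (intro that[of f' a b]) auto
qed

lemma reach_unique:
  "reach X d n k f \<Longrightarrow> reach X d n k g \<Longrightarrow> matching n k f = matching n k g \<Longrightarrow>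
    u < n \<Longrightarrow> \<not> f u < 2 * k \<Longrightarrow> f u = g u"
proof (induction k arbitrary: f g u)
  case 0
  have "f = id" if "reach X d n 0 f" for f
    using that by cases simp_all
  from this[OF 0(1)] this[OF 0(2)] show ?case by simp
next
  case (Suc k)
  obtain f' a b where f': "reach X d n k f'" "f = slide X d (f' a) (f' b) \<circ> f'" "a < n" "b < n" "a \<noteq> b"
    "\<not> f' a < 2 * k" "\<not> f' b < 2 * k" "matching n (Suc k) f = insert {a, b} (matching n k f')"
    "{a, b} \<notin> matching n k f'"
    using Suc.prems(1) by (rule reach_SucE)
  obtain g' c e where g': "reach X d n k g'" "g = slide X d (g' c) (g' e) \<circ> g'" "c < n" "e < n" "c \<noteq> e"
    "\<not> g' c < 2 * k" "\<not> g' e < 2 * k" "matching n (Suc k) g = insert {c, e} (matching n k g')"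
    "{c, e} \<notin> matching n k g'"
    using Suc.prems(2) by (rule reach_SucE)
  note pf' = reach_permutes[OF f'(1)] and pg' = reach_permutes[OF g'(1)]
  note U = Union_matching[OF reach_permutes reach_le]
  have eq: "insert {a, b} (matching n k f') = insert {c, e} (matching n k g')"
    using f'(8) g'(8) Suc.prems(3) by simp
  have "u \<notin> \<Union> (matching n (Suc k) f)" using U[OF Suc.prems(1,1)] Suc.prems(5) by simp
  then have "u \<notin> \<Union> (insert {a, b} (matching n k f'))" "u \<notin> \<Union> (insert {c, e} (matching n k g'))"
    using f'(8) eq by simp_all
  then have "u \<notin> {a, b}" "u \<notin> {c, e}" "u \<notin> \<Union> (matching n k f')" "u \<notin> \<Union> (matching n k g')"
    by blast+
  then have u: "u \<notin> {a, b}" "u \<notin> {c, e}" "\<not> f' u < 2 * k" "\<not> g' u < 2 * k"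
    unfolding U[OF f'(1,1)] U[OF g'(1,1)] using Suc.prems(4) by simp_all
  show ?case
  proof (cases "{a, b} = {c, e}")
    case True
    have "matching n k f' = matching n k g'"
      using eq f'(9) g'(9) unfolding True by (rule insert_ident[THEN iffD1, rotated 2])
    from Suc.IH[OF f'(1) g'(1) this] have "f' u = g' u" "f' a = g' a" "f' b = g' b"
      using f'(3,4,6,7) Suc.prems(4) u(3) by blast+
    moreover have "slide X d (g' a) (g' b) = slide X d (g' c) (g' e)"
    proof -
      from True consider "a = c" "b = e" | "a = e" "b = c" by (auto simp: doubleton_eq_iff)
      then show ?thesis by cases (simp_all add: slide_commute[of X d "g' c"])
    qed
    ultimately show ?thesis unfolding f'(2) g'(2) o_apply by (simp only:)
  next
    case False
    let ?M = "matching n (Suc k) f"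
    have in_M: "{a, b} \<in> ?M" "{c, e} \<in> ?M" unfolding f'(8) by (simp, simp add: eq)
    have disj: "{a, b} \<inter> {c, e} = {}"
      using matching_disjoint[OF reach_permutes[OF Suc.prems(1)] in_M False] .
    \<comment> \<open>Without both last pairs, so that adding either of them gives the matching of
      f' or of g'.\<close>
    let ?E = "?M - {{a, b}, {c, e}}"
    have "\<exists>j h. reach X d n j h \<and> matching n j h = ?E"
    proof (rule reach_matching_exists)
      have "?M \<subseteq> Pow {..<n}" using matching_doubleton by fastforce
      then have "finite ?M" by (rule finite_subset) simp
      then show "finite ?E" by simp
      show "\<forall>S\<in>?E. \<exists>u v. S = {u, v} \<and> u < n \<and> v < n \<and> u \<noteq> v"
        using matching_doubleton by blast
      show "\<forall>S\<in>?E. \<forall>T\<in>?E. S \<noteq> T \<longrightarrow> S \<inter> T = {}"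
        using matching_disjoint[OF reach_permutes[OF Suc.prems(1)]] by blast
    qed
    then obtain j h where h: "reach X d n j h" "matching n j h = ?E" by blast
    note ph = reach_permutes[OF h(1)]
    have "w \<notin> \<Union> ?E" if "w \<in> S" "S \<in> ?M" "S \<notin> ?E" for w S
      using matching_disjoint[OF reach_permutes[OF Suc.prems(1)] that(2)] that by blast
    then have "a \<notin> \<Union> ?E" "b \<notin> \<Union> ?E" "c \<notin> \<Union> ?E" "e \<notin> \<Union> ?E"
      using in_M by (meson DiffD2 insertCI)+
    moreover have "u \<notin> \<Union> ?E" using \<open>u \<notin> \<Union> ?M\<close> by blast
    moreover have "\<Union> ?E = {w. w < n \<and> h w < 2 * j}" using U[OF h(1) h(1)] h(2) by simp
    ultimately have nh: "\<not> h a < 2 * j" "\<not> h b < 2 * j" "\<not> h c < 2 * j" "\<not> h e < 2 * j" "\<not> h u < 2 * j"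
      using f'(3,4) g'(3,4) Suc.prems(4) by simp_all
    let ?f = "slide X d (h a) (h b) \<circ> h" and ?g = "slide X d (h c) (h e) \<circ> h"
    note rf = reach_extend[OF h(1) f'(3-5) nh(1,2)] and rg = reach_extend[OF h(1) g'(3-5) nh(3,4)]
    have two: "insert P (insert Q G - {P, Q}) = G" if "P \<noteq> Q" "P \<in> insert Q G" "Q \<notin> G"
      for P Q :: "nat set" and G
      using that by blast
    have "matching n (j + 1) ?f = insert {a, b} (insert {c, e} (matching n k g') - {{a, b}, {c, e}})"
      using matching_extend[OF ph f'(3-5) nh(1,2)] h(2) unfolding f'(8) eq by (simp only:)
    then have mf': "matching n (j + 1) ?f = matching n k g'"
      using two[OF False _ g'(9)] in_M(1) unfolding f'(8) eq by (simp only:)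
    have "matching n (j + 1) ?g = insert {c, e} (insert {a, b} (matching n k f') - {{c, e}, {a, b}})"
      using matching_extend[OF ph g'(3-5) nh(3,4)] h(2) unfolding f'(8) insert_commute[of "{c, e}" "{a, b}" "{}"]
      by (simp only:)
    then have mg': "matching n (j + 1) ?g = matching n k f'"
      using two[OF False[symmetric] _ f'(9)] in_M(2) unfolding f'(8) by (simp only:)
    \<comment> \<open>Counting matched pins shows that the extensions of h have exactly k pairs, so
      the induction hypothesis applies to them.\<close>
    have j: "j + 1 = k"
      using card_Union_matching[OF reach_permutes reach_le, OF rf rf]
        card_Union_matching[OF reach_permutes reach_le, OF g'(1,1)] mf' by simp
    \<comment> \<open>Crosswise: f' lacks the pair {a, b}, so it is compared with h extended by {c,
      e}.\<close>
    have f'_eq: "f' w = ?g w" if "w < n" "\<not> f' w < 2 * k" for w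
      by (rule Suc.IH[OF f'(1) rg[unfolded j] mg'[unfolded j, symmetric] that])
    have g'_eq: "g' w = ?f w" if "w < n" "\<not> g' w < 2 * k" for w
      by (rule Suc.IH[OF g'(1) rf[unfolded j] mf'[unfolded j, symmetric] that])
    have "slide X d (slide X d (h a) (h b) (h c)) (slide X d (h a) (h b) (h e)) (slide X d (h a) (h b) (h u)) =
        slide X d (slide X d (h c) (h e) (h a)) (slide X d (h c) (h e) (h b)) (slide X d (h c) (h e) (h u))"
      by (rule slide_exchange) (use f'(5) g'(5) disj u in \<open>auto simp: permutes_eq_iff[OF ph]\<close>)
    then show ?thesis
      unfolding f'(2) g'(2) o_apply f'_eq[OF f'(3,6)] f'_eq[OF f'(4,7)] f'_eq[OF Suc.prems(4) u(3)]
        g'_eq[OF g'(3,6)] g'_eq[OF g'(4,7)] g'_eq[OF Suc.prems(4) u(4)] by (rule sym)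
  qed
qed

section \<open>Canonical diagrams are determined by their matching\<close>

lemma canon_Lpins:
  assumes "f permutes {..<n}" "u < n" "v < n"
  shows "{Lpin (n - u), Lpin (n - v)} \<in> canon n k f \<longleftrightarrow> {u, v} \<in> matching n k f"
  using assms(2,3) permutes_eq_iff[OF assms(1)] block_less_iff[of "f u" "f v" k]
  unfolding canon_joined(1)[OF assms(2,3)] code_eq_iff mem_matching by auto

text \<open>Left blocks are the matching, right blocks depend on k alone, and lines from left to
  right involve only the values settled by \<open>reach_unique\<close>. The size of the matching
  gives k.\<close>

lemma canon_eq:
  assumes f: "reach X d n k f" and g: "reach X d n m g" and eq: "matching n k f = matching n m g"
  shows "canon n k f = canon n m g"
proof -
  note U = Union_matching[OF reach_permutes reach_le]
  note pf = reach_permutes[OF f] and pg = reach_permutes[OF g]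
  have k: "m = k"
    using card_Union_matching[OF reach_permutes reach_le, OF f f]
      card_Union_matching[OF reach_permutes reach_le, OF g g] eq by simp
  have less: "f u < 2 * k \<longleftrightarrow> g u < 2 * k" if "u < n" for u
    using U[OF f f] U[OF g g] eq that unfolding k by blast
  have same: "f u = g u" if "u < n" "\<not> f u < 2 * k" for u
    using reach_unique[OF f g[unfolded k] eq[unfolded k] that] .
  have LL: "{Lpin (n - u), Lpin (n - v)} \<in> canon n k f \<longleftrightarrow> {Lpin (n - u), Lpin (n - v)} \<in> canon n k g"
    if "u < n" "v < n" for u v
    unfolding canon_Lpins[OF pf that] canon_Lpins[OF pg that] eq[unfolded k] ..
  have LR: "{Lpin (n - u), Rpin (n - v)} \<in> canon n k f \<longleftrightarrow> {Lpin (n - u), Rpin (n - v)} \<in> canon n k g"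
    if "u < n" "v < n" for u v
    unfolding canon_joined(3)[OF that] code_eq_iff using less[OF that(1)] same[OF that(1)] by auto
  have RR: "{Rpin (n - u), Rpin (n - v)} \<in> canon n k f \<longleftrightarrow> {Rpin (n - u), Rpin (n - v)} \<in> canon n k g"
    if "u < n" "v < n" for u v
    unfolding canon_joined(2)[OF that] ..
  have "canon n k f = canon n k g"
  proof (rule diagram_eqI)
    fix p q
    show "{p, q} \<in> canon n k f \<longleftrightarrow> {p, q} \<in> canon n k g"
    proof (cases "p \<in> pins n \<and> q \<in> pins n")
      case True
      then have "p \<in> pins n" "q \<in> pins n" by auto
      then show ?thesis
        by (elim pins_cases) (simp_all add: LL LR RR insert_commute[of "Rpin _" "Lpin _"])
    next
      case False
      then show ?thesis unfolding canon_def mem_labelled by blast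
    qed
  qed (auto simp: canon_def labelled_def)
  then show ?thesis by (simp add: k)
qed

section \<open>The canonical cross-section\<close>

lemma labelled_in_brauer:
  assumes "\<And>p. p \<in> pins n \<Longrightarrow>
    \<exists>q\<in>pins n. q \<noteq> p \<and> l q = l p \<and> (\<forall>r\<in>pins n. l r = l p \<longrightarrow> r = p \<or> r = q)"
  shows "labelled n l \<in> brauer n"
proof -
  have "partition_on (pins n) (labelled n l)"
  proof (rule partition_onI)
    show "\<Union> (labelled n l) = pins n"
    proof
      show "pins n \<subseteq> \<Union> (labelled n l)"
      proof
        fix p assume "p \<in> pins n"
        with assms obtain q where "q \<in> pins n" "q \<noteq> p" "l q = l p" by metis
        with \<open>p \<in> pins n\<close> have "{p, q} \<in> labelled n l" unfolding mem_labelled by simp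
        then show "p \<in> \<Union> (labelled n l)" by blast
      qed
    qed (auto simp: labelled_def)
  next
    fix B C assume B: "B \<in> labelled n l" and C: "C \<in> labelled n l" and "B \<noteq> C"
    show "disjnt B C"
    proof (rule ccontr)
      assume "\<not> disjnt B C"
      then obtain p where p: "p \<in> B" "p \<in> C" by (auto simp: disjnt_def)
      have "\<exists>q\<in>pins n. D = {p, q} \<and> q \<noteq> p \<and> l q = l p \<and> p \<in> pins n" if "D \<in> labelled n l" "p \<in> D" for D
        using that unfolding labelled_def by (auto simp: insert_commute)
      then obtain q r where qr: "q \<in> pins n" "B = {p, q}" "q \<noteq> p" "l q = l p" "p \<in> pins n"
        "r \<in> pins n" "C = {p, r}" "r \<noteq> p" "l r = l p"
        using B C p by metis
      with assms have "q = r" by metis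
      with qr \<open>B \<noteq> C\<close> show False by simp
    qed
  qed (auto simp: labelled_def)
  moreover have "\<forall>B\<in>labelled n l. card B = 2"
    unfolding labelled_def by auto
  ultimately show ?thesis
    unfolding brauer_def pins_def[symmetric] by simp
qed

lemma canon_in_brauer:
  assumes f: "f permutes {..<n}" and k: "2 * k \<le> n"
  shows "canon n k f \<in> brauer n"
  unfolding canon_def
proof (rule labelled_in_brauer)
  let ?l = "canon_label n k f"
  have mate_less: "mate v < 2 * k" if "v < 2 * k" for v
    using that block_less_iff[OF mate(1)] by blast
  have L: "\<exists>q\<in>pins n. q \<noteq> p \<and> ?l q = ?l p \<and> (\<forall>r\<in>pins n. ?l r = ?l p \<longrightarrow> r = p \<or> r = q)"
    if p: "p \<in> pins n" and Q: "q \<in> pins n" "q \<noteq> p" "?l q = ?l p"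
      "\<And>w. w < n \<Longrightarrow> ?l (Lpin (n - w)) = ?l p \<Longrightarrow> Lpin (n - w) = p \<or> Lpin (n - w) = q"
      "\<And>w. w < n \<Longrightarrow> ?l (Rpin (n - w)) = ?l p \<Longrightarrow> Rpin (n - w) = p \<or> Rpin (n - w) = q" for p q
  proof (intro bexI[OF _ Q(1)] conjI Q(2,3) ballI impI)
    fix r assume "r \<in> pins n" "?l r = ?l p"
    then show "r = p \<or> r = q"
      by (elim pins_cases) (use Q(4,5) in blast)+
  qed
  fix p assume p: "p \<in> pins n"
  then show "\<exists>q\<in>pins n. q \<noteq> p \<and> ?l q = ?l p \<and> (\<forall>r\<in>pins n. ?l r = ?l p \<longrightarrow> r = p \<or> r = q)"
  proof (rule pins_cases)
    fix u assume u: "u < n" "p = Lpin (n - u)"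
    show ?thesis
    proof (cases "f u < 2 * k")
      case True
      then have "mate (f u) < 2 * k" by (rule mate_less)
      with k have "mate (f u) < n" by simp
      with f obtain v where v: "v < n" "f v = mate (f u)" by (rule permutes_surj_less)
      show ?thesis
      proof (rule L[OF p])
        show "Lpin (n - v) \<in> pins n" using v by (simp add: mem_pins)
        have "v \<noteq> u" using v mate(2)[of "f u"] by auto
        then show "Lpin (n - v) \<noteq> p" using u v(1) by auto
        show "?l (Lpin (n - v)) = ?l p"
          using u v True \<open>mate (f u) < 2 * k\<close> mate(1)[of "f u"] by (simp add: code_eq_iff)
        show "Lpin (n - w) = p \<or> Lpin (n - w) = Lpin (n - v)" if "w < n" "?l (Lpin (n - w)) = ?l p" for w
          using that u v mate_unique[of "f w" "f u"] permutes_eq_iff[OF f, of w u] permutes_eq_iff[OF f, of w v]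
          by (auto simp: code_eq_iff)
        show "Rpin (n - w) = p \<or> Rpin (n - w) = Lpin (n - v)" if "w < n" "?l (Rpin (n - w)) = ?l p" for w
          using that u True code_eq_iff(3)[of k "f u" w] by simp
      qed
    next
      case False
      show ?thesis
      proof (rule L[OF p])
        show "Rpin (n - f u) \<in> pins n" using u permutes_less[OF f, of u] by (simp add: mem_pins)
        show "Rpin (n - f u) \<noteq> p" using u by simp
        show "?l (Rpin (n - f u)) = ?l p"
          using u False permutes_less[OF f, of u] code_eq_iff(3)[of k "f u" "f u"] by simp
        show "Lpin (n - w) = p \<or> Lpin (n - w) = Rpin (n - f u)" if "w < n" "?l (Lpin (n - w)) = ?l p" for w
          using that u False permutes_eq_iff[OF f, of w u] by (auto simp: code_eq_iff)
        show "Rpin (n - w) = p \<or> Rpin (n - w) = Rpin (n - f u)" if "w < n" "?l (Rpin (n - w)) = ?l p" for w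
          using that u code_eq_iff(3)[of k "f u" w] by simp
      qed
    qed
  next
    fix u assume u: "u < n" "p = Rpin (n - u)"
    show ?thesis
    proof (cases "u < 2 * k")
      case True
      then have m: "mate u < 2 * k" by (rule mate_less)
      with k have m': "mate u < n" by simp
      show ?thesis
      proof (rule L[OF p])
        show "Rpin (n - mate u) \<in> pins n" using m' by (simp add: mem_pins)
        show "Rpin (n - mate u) \<noteq> p" using u m' mate(2)[of u] by auto
        show "?l (Rpin (n - mate u)) = ?l p"
          using u True m m' mate(1)[of u] by (simp add: code_eq_iff)
        show "Rpin (n - w) = p \<or> Rpin (n - w) = Rpin (n - mate u)" if "w < n" "?l (Rpin (n - w)) = ?l p" for w
          using that u mate_unique[of w u] by (auto simp: code_eq_iff)
        show "Lpin (n - w) = p \<or> Lpin (n - w) = Rpin (n - mate u)" if "w < n" "?l (Lpin (n - w)) = ?l p" for w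
          using that u True by (simp add: code_eq_iff)
      qed
    next
      case False
      obtain v where v: "v < n" "f v = u" using f u(1) by (rule permutes_surj_less)
      show ?thesis
      proof (rule L[OF p])
        show "Lpin (n - v) \<in> pins n" using v by (simp add: mem_pins)
        show "Lpin (n - v) \<noteq> p" using u by simp
        show "?l (Lpin (n - v)) = ?l p" using u v False by (simp add: code_eq_iff)
        show "Rpin (n - w) = p \<or> Rpin (n - w) = Lpin (n - v)" if "w < n" "?l (Rpin (n - w)) = ?l p" for w
          using that u False by (auto simp: code_eq_iff)
        show "Lpin (n - w) = p \<or> Lpin (n - w) = Lpin (n - v)" if "w < n" "?l (Lpin (n - w)) = ?l p" for w
          using that u v permutes_eq_iff[OF f, of w v] by (auto simp: code_eq_iff)
      qed
    qed
  qed
qed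

lemma corank_canon:
  assumes f: "f permutes {..<n}" and k: "2 * k \<le> n"
  shows "corank n (canon n k f) = 2 * k"
proof -
  let ?U = "{u. u < n \<and> \<not> f u < 2 * k}" and ?B = "\<lambda>u. {Lpin (n - u), Rpin (n - f u)}"
  have "{B \<in> canon n k f. \<exists>c\<in>{1..n}. \<exists>d\<in>{1..n}. B = {Lpin c, Rpin d}} = ?B ` ?U"
  proof
    show "?B ` ?U \<subseteq> {B \<in> canon n k f. \<exists>c\<in>{1..n}. \<exists>d\<in>{1..n}. B = {Lpin c, Rpin d}}"
    proof
      fix B assume "B \<in> ?B ` ?U"
      then obtain u where u: "u < n" "\<not> f u < 2 * k" "B = ?B u" by blast
      then have "f u < n" using permutes_less[OF f] by simp
      with u have "B \<in> canon n k f" by (simp add: canon_joined(3) code_eq_iff)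
      moreover have "n - u \<in> {1..n}" "n - f u \<in> {1..n}" using u \<open>f u < n\<close> by auto
      ultimately show "B \<in> {B \<in> canon n k f. \<exists>c\<in>{1..n}. \<exists>d\<in>{1..n}. B = {Lpin c, Rpin d}}"
        using u(3) by blast
    qed
    show "{B \<in> canon n k f. \<exists>c\<in>{1..n}. \<exists>d\<in>{1..n}. B = {Lpin c, Rpin d}} \<subseteq> ?B ` ?U"
    proof
      fix B assume "B \<in> {B \<in> canon n k f. \<exists>c\<in>{1..n}. \<exists>d\<in>{1..n}. B = {Lpin c, Rpin d}}"
      then obtain c d where cd: "{Lpin c, Rpin d} \<in> canon n k f" "c \<in> {1..n}" "d \<in> {1..n}" "B = {Lpin c, Rpin d}"
        by blast
      define u v where "u = n - c" and "v = n - d"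
      have uv: "u < n" "v < n" "c = n - u" "d = n - v" using cd unfolding u_def v_def by auto
      with cd(1) have "v = f u" "\<not> f u < 2 * k" by (simp_all add: canon_joined(3) code_eq_iff)
      with uv cd(4) show "B \<in> ?B ` ?U" by blast
    qed
  qed
  moreover have "inj_on ?B ?U" by (rule inj_onI) (auto simp: doubleton_eq_iff)
  moreover have "card ?U = n - 2 * k"
  proof -
    have "?U = {..<n} - \<Union> (matching n k f)" by (auto simp: Union_matching[OF f k])
    moreover have "\<Union> (matching n k f) \<subseteq> {..<n}" by (auto simp: Union_matching[OF f k])
    moreover from this have "finite (\<Union> (matching n k f))" by (rule finite_subset) simp
    ultimately show ?thesis
      by (simp only: card_Diff_subset card_Union_matching[OF f k] card_lessThan)
  qed
  ultimately show ?thesis unfolding corank_def using k by (simp add: card_image)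
qed

section \<open>The R-class of a canonical diagram\<close>

definition Lpins :: "nat \<Rightarrow> nat set \<Rightarrow> pin set" where
  "Lpins n S = (\<lambda>u. Lpin (n - u)) ` S"

lemma inj_on_Lpin: "inj_on (\<lambda>u. Lpin (n - u)) {..<n}"
  by (rule inj_onI) auto

lemma left_pinsD:
  assumes "p \<in> left_pins n"
  shows "\<exists>u<n. p = Lpin (n - u)"
proof -
  obtain c where "p = Lpin c" "c \<in> {1..n}" using assms unfolding left_pins_def by blast
  then show ?thesis by (intro exI[of _ "n - c"]) auto
qed

lemma left_blocks_canon:
  assumes f: "f permutes {..<n}"
  shows "{B \<in> canon n k f. B \<subseteq> left_pins n} = Lpins n ` matching n k f"
proof
  show "Lpins n ` matching n k f \<subseteq> {B \<in> canon n k f. B \<subseteq> left_pins n}"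
  proof
    fix B assume "B \<in> Lpins n ` matching n k f"
    then obtain S where S: "S \<in> matching n k f" "B = Lpins n S" by blast
    then obtain u v where "S = {u, v}" "u < n" "v < n" using matching_doubleton by metis
    with S have uv: "u < n" "v < n" "{u, v} \<in> matching n k f" "B = {Lpin (n - u), Lpin (n - v)}"
      by (simp_all add: Lpins_def)
    then show "B \<in> {B \<in> canon n k f. B \<subseteq> left_pins n}"
      using canon_Lpins[OF f uv(1,2), of k] by (auto simp: left_pins_def)
  qed
  show "{B \<in> canon n k f. B \<subseteq> left_pins n} \<subseteq> Lpins n ` matching n k f"
  proof
    fix B assume "B \<in> {B \<in> canon n k f. B \<subseteq> left_pins n}"
    then obtain p q where pq: "{p, q} \<in> canon n k f" "p \<in> left_pins n" "q \<in> left_pins n" "B = {p, q}"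
      unfolding canon_def labelled_def by auto
    then obtain u v where uv: "u < n" "v < n" "p = Lpin (n - u)" "q = Lpin (n - v)"
      using left_pinsD by metis
    then have "{u, v} \<in> matching n k f" "B = Lpins n {u, v}"
      using pq canon_Lpins[OF f uv(1,2), of k] by (auto simp: Lpins_def)
    then show "B \<in> Lpins n ` matching n k f" by blast
  qed
qed

lemma Lpins_inject: "S \<subseteq> {..<n} \<Longrightarrow> T \<subseteq> {..<n} \<Longrightarrow> Lpins n S = Lpins n T \<longleftrightarrow> S = T"
  unfolding Lpins_def by (rule inj_on_image_eq_iff[OF inj_on_Lpin])

lemma matching_subset: "matching n k f \<subseteq> Pow {..<n}"
  using matching_doubleton by fastforce

lemma matching_eq_of_left_blocks:
  assumes f: "f permutes {..<n}" and g: "g permutes {..<n}"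
    and "{B \<in> canon n k f. B \<subseteq> left_pins n} = {B \<in> canon n m g. B \<subseteq> left_pins n}"
  shows "matching n k f = matching n m g"
proof -
  have "inj_on (Lpins n) (Pow {..<n})" by (rule inj_onI) (simp add: Lpins_inject)
  moreover have "Lpins n ` matching n k f = Lpins n ` matching n m g"
    using assms(3) unfolding left_blocks_canon[OF f] left_blocks_canon[OF g] .
  ultimately show ?thesis
    by (simp add: inj_on_image_eq_iff matching_subset)
qed

text \<open>The left blocks of \<open>a\<close>, read in coordinates, are disjoint pairs; a product
  that reaches this matching has the same left blocks.\<close>

lemma reach_R_class:
  assumes a: "a \<in> brauer n"
  obtains k f where "reach X d n k f" "(a, canon n k f) \<in> green_R n"
proof -
  have part: "partition_on (left_pins n \<union> right_pins n) a" and card: "\<And>B. B \<in> a \<Longrightarrow> card B = 2"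
    using a unfolding brauer_def by auto
  define E where "E = {S. S \<subseteq> {..<n} \<and> Lpins n S \<in> a}"
  have "\<exists>k f. reach X d n k f \<and> matching n k f = E"
  proof (rule reach_matching_exists)
    have "E \<subseteq> Pow {..<n}" unfolding E_def by auto
    then show "finite E" by (rule finite_subset) simp
    show "\<forall>S\<in>E. \<exists>u v. S = {u, v} \<and> u < n \<and> v < n \<and> u \<noteq> v"
    proof
      fix S assume "S \<in> E"
      then have S: "S \<subseteq> {..<n}" "Lpins n S \<in> a" unfolding E_def by auto
      then have "card S = 2"
        using card card_image[OF inj_on_subset[OF inj_on_Lpin S(1)]] unfolding Lpins_def by simp
      with S show "\<exists>u v. S = {u, v} \<and> u < n \<and> v < n \<and> u \<noteq> v" by (auto simp: card_2_iff)
    qed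
    show "\<forall>S\<in>E. \<forall>T\<in>E. S \<noteq> T \<longrightarrow> S \<inter> T = {}"
    proof (intro ballI impI)
      fix S T assume "S \<in> E" "T \<in> E" "S \<noteq> T"
      then have "Lpins n S \<in> a" "Lpins n T \<in> a" "Lpins n S \<noteq> Lpins n T"
        unfolding E_def by (auto simp: Lpins_inject)
      with part have "Lpins n S \<inter> Lpins n T = {}" by (auto simp: partition_on_def disjoint_def)
      then show "S \<inter> T = {}" unfolding Lpins_def by auto
    qed
  qed
  then obtain k f where kf: "reach X d n k f" "matching n k f = E" by blast
  have f: "f permutes {..<n}" "2 * k \<le> n" using kf(1) reach_permutes reach_le by auto
  have "{B \<in> a. B \<subseteq> left_pins n} = Lpins n ` E"
  proof
    show "Lpins n ` E \<subseteq> {B \<in> a. B \<subseteq> left_pins n}"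
      unfolding E_def Lpins_def left_pins_def by auto
    show "{B \<in> a. B \<subseteq> left_pins n} \<subseteq> Lpins n ` E"
    proof
      fix B assume "B \<in> {B \<in> a. B \<subseteq> left_pins n}"
      then have B: "B \<in> a" "B \<subseteq> left_pins n" by auto
      define S where "S = {u. u < n \<and> Lpin (n - u) \<in> B}"
      have "B \<subseteq> Lpins n S"
      proof
        fix p assume "p \<in> B"
        with B obtain u where "u < n" "p = Lpin (n - u)"
          using left_pinsD by blast
        with \<open>p \<in> B\<close> show "p \<in> Lpins n S" unfolding Lpins_def S_def by blast
      qed
      then have "Lpins n S = B" unfolding Lpins_def S_def by auto
      with B show "B \<in> Lpins n ` E" unfolding E_def S_def by force
    qed
  qed
  then have "(a, canon n k f) \<in> green_R n"
    using a canon_in_brauer[OF f] left_blocks_canon[OF f(1), of k] kf(2) unfolding green_R_def by simp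
  with kf(1) show thesis by (rule that)
qed

section \<open>Closure under products\<close>

definition cross_section :: "(nat \<Rightarrow> bool) \<Rightarrow> bool \<Rightarrow> nat \<Rightarrow> diagram set" where
  "cross_section X d n = {canon n k f | k f. reach X d n k f}"

lemma canon_mult_id:
  assumes f: "f permutes {..<n}"
  shows "brauer_mult (canon n k f) (canon n 0 id) = canon n k f"
proof -
  define conn where "conn = (adjacent (canon n k f) (canon n 0 id))\<^sup>*"
  note E = canon_mult_edges[where n = n and k = k and f = f and m = 0 and h = id, folded conn_def]
  have S: "(y, x) \<in> conn" if "(x, y) \<in> conn" for x y
    using that sym_rtrancl_adjacent unfolding conn_def by (rule symD[rotated])
  have T: "(x, z) \<in> conn" if "(x, y) \<in> conn" "(y, z) \<in> conn" for x y z
    using that unfolding conn_def by (rule rtrancl_trans)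
  have MR: "(Mid (n - v), Outer (Rpin (n - v))) \<in> conn" if "v < n" for v
    using that by (intro E(5)) (auto simp: code_eq_iff)
  show ?thesis
  proof (rule canon_mult[where n = n and k = k and f = f and m = 0 and h = id and g = "rcode k", folded conn_def])
    fix u v assume uv: "u < n" "v < n"
    show "rcode k u = rcode k v" if "lcode 0 (id u) = lcode 0 (id v)" using that by (simp add: code_eq_iff)
    show "rcode k u = rcode k v" if "lcode 0 (id u) = rcode 0 v" using that by (simp add: code_eq_iff)
    show "rcode k u = rcode k v" if "rcode 0 u = rcode 0 v" using that by (simp add: code_eq_iff)
    show "(Outer (Lpin (n - u)), Outer (Lpin (n - v))) \<in> conn" if "lcode k (f u) = lcode k (f v)"
      using uv that by (rule E(1))
    show "(Outer (Lpin (n - u)), Outer (Rpin (n - v))) \<in> conn" if "lcode k (f u) = rcode k v"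
      using T[OF E(2)[OF uv that] MR[OF uv(2)]] .
    show "(Outer (Rpin (n - u)), Outer (Rpin (n - v))) \<in> conn" if "rcode k u = rcode k v"
      using T[OF S[OF MR[OF uv(1)]] T[OF E(3)[OF uv that] MR[OF uv(2)]]] .
  qed
qed

lemma cross_section_mult_generator:
  assumes a: "a \<in> cross_section X d n" and pq: "p < q" "q < n"
  shows "brauer_mult a (canon n 1 (slide X d p q)) \<in> cross_section X d n"
proof -
  obtain k f where kf: "a = canon n k f" "reach X d n k f" using a unfolding cross_section_def by blast
  note f = reach_permutes[OF kf(2)] and k = reach_le[OF kf(2)]
  show ?thesis
  proof (cases "2 * k \<le> p")
    case True
    with canon_mult_slide[OF f True pq] reach_Suc[OF kf(2) True pq] show ?thesis
      unfolding cross_section_def kf(1) by blast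
  next
    case False
    with canon_mult_absorb[OF f _ pq k] a show ?thesis unfolding kf(1) by simp
  qed
qed

text \<open>The right factor is itself built from generators by \<open>canon_mult_slide\<close>;
  associativity allows \<open>a\<close> to be multiplied by them one at a time.\<close>

lemma cross_section_mult:
  assumes a: "a \<in> cross_section X d n" and b: "b \<in> cross_section X d n"
  shows "brauer_mult a b \<in> cross_section X d n"
proof -
  obtain k f where "b = canon n k f" "reach X d n k f" using b unfolding cross_section_def by blast
  moreover from this(2) have "brauer_mult a (canon n k f) \<in> cross_section X d n"
  proof (induction rule: reach.induct)
    case reach_0
    obtain m g where mg: "a = canon n m g" "reach X d n m g" using a unfolding cross_section_def by blast
    show ?case using a unfolding mg(1) canon_mult_id[OF reach_permutes[OF mg(2)]] .
  next
    case (reach_Suc k f p q)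
    have "canon n (k + 1) (slide X d p q \<circ> f) = brauer_mult (canon n k f) (canon n 1 (slide X d p q))"
      using canon_mult_slide[OF reach_permutes] reach_Suc.hyps by metis
    then show ?case
      using cross_section_mult_generator[OF reach_Suc.IH] reach_Suc.hyps by (metis brauer_mult_assoc)
  qed
  ultimately show ?thesis by simp
qed

lemma generated_eq_cross_section:
  "generated ({canon n 0 id} \<union> {canon n 1 (slide X d p q) | p q. p < q \<and> q < n}) = cross_section X d n"
    (is "generated ?G = _")
proof
  have "reach X d n 1 (slide X d p q)" if "p < q" "q < n" for p q
    using reach_Suc[OF reach_0[where X = X and d = d and n = n], where p = p and q = q] that by simp
  then have "?G \<subseteq> cross_section X d n"
    unfolding cross_section_def using reach_0 by blast
  show "generated ?G \<subseteq> cross_section X d n"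
  proof
    fix a assume "a \<in> generated ?G"
    then show "a \<in> cross_section X d n"
      by induction (use \<open>?G \<subseteq> _\<close> cross_section_mult in blast)+
  qed
  show "cross_section X d n \<subseteq> generated ?G"
  proof
    fix a assume "a \<in> cross_section X d n"
    then obtain k f where "a = canon n k f" "reach X d n k f" unfolding cross_section_def by blast
    moreover from this(2) have "canon n k f \<in> generated ?G"
    proof induction
      case reach_0
      show ?case by (rule generated.base) simp
    next
      case (reach_Suc k f p q)
      have "canon n 1 (slide X d p q) \<in> generated ?G"
        by (rule generated.base) (use reach_Suc.hyps in blast)
      from generated.mult[OF reach_Suc.IH this] show ?case
        by (simp only: canon_mult_slide[OF reach_permutes[OF reach_Suc.hyps(1)] reach_Suc.hyps(2-4)])
    qed
    ultimately show "a \<in> generated ?G" by simp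
  qed
qed

lemma canonical_cross_section: "canonical_R_cross_section n (cross_section X d n)"
proof -
  have "cross_section X d n \<subseteq> brauer n"
    unfolding cross_section_def using canon_in_brauer reach_permutes reach_le by blast
  then have "subsemigroup n (cross_section X d n)"
    unfolding subsemigroup_def using cross_section_mult by blast
  moreover have "\<exists>!a. a \<in> cross_section X d n \<inter> C" if C: "C \<in> brauer n // green_R n" for C
  proof -
    obtain a where a: "a \<in> brauer n" "C = green_R n `` {a}" using C by (auto elim: quotientE)
    obtain k f where kf: "reach X d n k f" "(a, canon n k f) \<in> green_R n" using a(1) by (rule reach_R_class)
    show ?thesis
    proof (rule ex1I)
      show "canon n k f \<in> cross_section X d n \<inter> C"
        using kf a(2) unfolding cross_section_def by blast
      fix b assume "b \<in> cross_section X d n \<inter> C"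
      then obtain m g where mg: "b = canon n m g" "reach X d n m g" and "(a, b) \<in> green_R n"
        using a(2) unfolding cross_section_def by blast
      with kf(2) have "{B \<in> canon n m g. B \<subseteq> left_pins n} = {B \<in> canon n k f. B \<subseteq> left_pins n}"
        unfolding green_R_def by auto
      then have "matching n m g = matching n k f"
        using matching_eq_of_left_blocks[OF reach_permutes[OF mg(2)] reach_permutes[OF kf(1)]] by blast
      then show "b = canon n k f" unfolding mg(1) by (rule canon_eq[OF mg(2) kf(1)])
    qed
  qed
  moreover have "joined a (Rpin (n - 2 * r + 1)) (Rpin (n - 2 * r + 2))"
    if a: "a \<in> cross_section X d n" "corank n a = 2 * k" and r: "r \<in> {1..k}" for a k r
  proof -
    obtain m f where mf: "a = canon n m f" "reach X d n m f" using a(1) unfolding cross_section_def by blast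
    note f = reach_permutes[OF mf(2)] and m = reach_le[OF mf(2)]
    have "m = k" using a(2) corank_canon[OF f m] mf(1) by simp
    \<comment> \<open>The two pins have the coordinates 2r-1 and 2r-2 and so form block r-1; 2r <= n
      keeps the truncated subtractions exact.\<close>
    with r m have *: "2 * r - 1 < n" "2 * r - 2 < n" "n - 2 * r + 1 = n - (2 * r - 1)" "n - 2 * r + 2 = n - (2 * r - 2)"
      by auto
    obtain r' where r': "r = Suc r'" using r by (cases r) auto
    show ?thesis
      unfolding joined_def mf(1) *(3,4) canon_joined(2)[OF *(1,2)] code_eq_iff
      using r \<open>m = k\<close> unfolding r' by simp
  qed
  ultimately show ?thesis
    unfolding canonical_R_cross_section_def R_cross_section_def by blast
qed

section \<open>The elements $\alpha_{i,j}$\<close>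

lemma brauer_block_unique:
  assumes "a \<in> brauer n" "A \<in> a" "B \<in> a" "p \<in> A" "p \<in> B"
  shows "A = B"
proof -
  have "A \<noteq> B \<longrightarrow> A \<inter> B = {}"
    using assms(1-3) unfolding brauer_def partition_on_def disjoint_def by blast
  with assms(4,5) show ?thesis by blast
qed

text \<open>Both sets partition the same pins. To identify an alpha it is therefore enough to find
  every block of the canonical diagram in it.\<close>

lemma brauer_subset_eq:
  assumes a: "a \<in> brauer n" and b: "b \<in> brauer n" and "a \<subseteq> b"
  shows "a = b"
proof
  show "b \<subseteq> a"
  proof
    fix B assume B: "B \<in> b"
    with b have "B \<noteq> {}" "B \<subseteq> \<Union> b" unfolding brauer_def partition_on_def by auto
    then obtain p where "p \<in> B" "p \<in> \<Union> b" by blast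
    moreover have "\<Union> a = \<Union> b" using a b unfolding brauer_def partition_on_def by simp
    ultimately obtain A where "A \<in> a" "p \<in> A" by blast
    with \<open>a \<subseteq> b\<close> B \<open>p \<in> B\<close> have "A = B"
      by (intro brauer_block_unique[OF b]) auto
    with \<open>A \<in> a\<close> show "B \<in> a" by simp
  qed
qed (rule \<open>a \<subseteq> b\<close>)

lemma brauer_unique:
  assumes "a \<in> brauer n" "{p, r} \<in> a" "{q, r} \<in> a"
  shows "p = q"
proof -
  have "{p, r} = {q, r}"
    using assms by (rule brauer_block_unique[of _ _ _ _ r]) simp_all
  then show ?thesis by (auto simp: doubleton_eq_iff)
qed

text \<open>\<open>Z s\<close> is the permutation prescribed by (a) or by (b), whichever applies.
  The assumption on it is the only link between x, y and the encoding by \<open>X\<close> and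
  \<open>d\<close>.\<close>

context
  fixes n i j :: nat and x y Z :: "nat \<Rightarrow> nat \<Rightarrow> nat" and X :: "nat \<Rightarrow> bool" and d :: bool and p q :: nat
  assumes ij: "1 \<le> i" "i < j" "j \<le> n"
  defines "p \<equiv> n - j" and "q \<equiv> n - i" and "Z \<equiv> (if (i, j) \<in> A_pairs n then x else y)"
  assumes Z: "\<And>s. s \<in> {1..p div 2} \<Longrightarrow> Z s = (if X s \<noteq> (d \<and> p div 2 \<noteq> q div 2) then transpose 1 2 else id)"
begin

lemma pq: "p < q" "q < n" "j = n - p" "i = n - q" "p < n"
  using ij unfolding p_def q_def by auto

lemma transpose_neq_id: "transpose (1::nat) 2 \<noteq> id"
  by (metis id_apply one_eq_numeral_iff semiring_norm(83) transpose_apply_first)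

lemma cond_ab_iff:
  "cond_a n x i j a \<and> cond_b n y i j a \<longleftrightarrow> (\<forall>s\<in>{1..p div 2}. swap_part n a s = Z s)"
proof (cases "j \<le> n - 2")
  case True
  then show ?thesis unfolding cond_a_def cond_b_def Z_def p_def by auto
next
  case False
  then have "(n - j) div 2 = 0" by simp
  then show ?thesis unfolding cond_a_def cond_b_def p_def by simp
qed

text \<open>The index s starts at 1 but blocks are numbered from 0: the permutation with index s
  governs the passage from block s-1 to block s. The bound \<open>2 * r + 3 < n\<close> keeps all
  four pins positive.\<close>

lemma block_coords:
  assumes "s \<in> {1..p div 2}"
  obtains r where "s = Suc r" "2 * r + 3 < n" "2 * s \<le> p"
    "n - 2 * s + 2 = n - 2 * r" "n - 2 * s + 1 = n - (2 * r + 1)"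
    "n - 2 * s = n - (2 * r + 2)" "n - 2 * s - 1 = n - (2 * r + 3)"
proof -
  obtain r where r: "s = Suc r" using assms by (cases s) auto
  moreover have "2 * s \<le> p" using assms by auto
  ultimately show thesis using pq by (intro that[of r]) auto
qed

lemma slide_block_coords:
  assumes "2 * Suc r \<le> p"
  shows "slide X d p q (2 * r) = 2 * r + (if X (Suc r) \<noteq> (d \<and> p div 2 \<noteq> q div 2) then 3 else 2)"
    and "slide X d p q (2 * r + 1) = 2 * r + (if X (Suc r) \<noteq> (d \<and> p div 2 \<noteq> q div 2) then 2 else 3)"
proof -
  have "r < p div 2" using assms by auto
  then have "slide X d p q (2 * r) = shift X (d \<and> p div 2 \<noteq> q div 2) (2 * r)"
    "slide X d p q (2 * r + 1) = shift X (d \<and> p div 2 \<noteq> q div 2) (2 * r + 1)"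
    using assms pq(1) by (auto intro!: slide_simps(3))
  moreover have "shift X t (2 * r) = 2 * r + (if X (Suc r) \<noteq> t then 3 else 2)"
    "shift X t (2 * r + 1) = 2 * r + (if X (Suc r) \<noteq> t then 2 else 3)" for t
    by (simp_all add: shift_def)
  ultimately show "slide X d p q (2 * r) = 2 * r + (if X (Suc r) \<noteq> (d \<and> p div 2 \<noteq> q div 2) then 3 else 2)"
    "slide X d p q (2 * r + 1) = 2 * r + (if X (Suc r) \<noteq> (d \<and> p div 2 \<noteq> q div 2) then 2 else 3)"
    by (simp_all only:)
qed

lemma is_alpha_low:
  assumes a: "is_alpha n x y i j a" and r: "2 * Suc r \<le> p"
  shows "{Lpin (n - 2 * r), Rpin (n - slide X d p q (2 * r))} \<in> a"
    and "{Lpin (n - (2 * r + 1)), Rpin (n - slide X d p q (2 * r + 1))} \<in> a"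
proof -
  have "Suc r \<in> {1..p div 2}" using r by auto
  then obtain r' where "Suc r = Suc r'" and c: "2 * r' + 3 < n" "2 * Suc r \<le> p"
    "n - 2 * Suc r + 2 = n - 2 * r'" "n - 2 * Suc r + 1 = n - (2 * r' + 1)"
    "n - 2 * Suc r = n - (2 * r' + 2)" "n - 2 * Suc r - 1 = n - (2 * r' + 3)"
    by (rule block_coords)
  then have "r' = r" by simp
  note c = c[unfolded this]
  have a': "a \<in> brauer n" using a unfolding is_alpha_def by simp
  have "j \<le> n - 2" using r pq by auto
  moreover have "cond4 n j a" using a unfolding is_alpha_def by simp
  ultimately have *: "\<forall>k\<in>{1..p div 2}. \<forall>s\<in>{n - 2 * k + 2, n - 2 * k + 1}.
      \<exists>t\<in>{n - 2 * k, n - 2 * k - 1}. joined a (Lpin s) (Rpin t)"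
    unfolding cond4_def p_def by blast
  have "\<exists>t\<in>{n - 2 * Suc r, n - 2 * Suc r - 1}. joined a (Lpin s) (Rpin t)"
    if "s \<in> {n - 2 * Suc r + 2, n - 2 * Suc r + 1}" for s
    using * \<open>Suc r \<in> {1..p div 2}\<close> that by blast
  from this[of "n - 2 * Suc r + 2"] this[of "n - 2 * Suc r + 1"]
  have 0: "joined a (Lpin (n - 2 * r)) (Rpin (n - (2 * r + 2))) \<or> joined a (Lpin (n - 2 * r)) (Rpin (n - (2 * r + 3)))"
    and 1: "joined a (Lpin (n - (2 * r + 1))) (Rpin (n - (2 * r + 2))) \<or>
      joined a (Lpin (n - (2 * r + 1))) (Rpin (n - (2 * r + 3)))"
    unfolding c(3,4) unfolding c(6) unfolding c(5) by blast+
  have "swap_part n a (Suc r) = Z (Suc r)"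
    using cond_ab_iff[of a] a \<open>Suc r \<in> {1..p div 2}\<close> unfolding is_alpha_def by blast
  \<comment> \<open>The default \<open>undefined\<close> never occurs, since \<open>0\<close> grants
    one of the first two cases.\<close>
  then have sw: "(if joined a (Lpin (n - 2 * r)) (Rpin (n - (2 * r + 2))) then id
      else if joined a (Lpin (n - 2 * r)) (Rpin (n - (2 * r + 3))) then transpose (1 :: nat) 2
      else undefined) = (if X (Suc r) \<noteq> (d \<and> p div 2 \<noteq> q div 2) then transpose 1 2 else id)"
    unfolding swap_part_def c(3) Z[OF \<open>Suc r \<in> _\<close>] unfolding c(6) unfolding c(5) .
  \<comment> \<open>The prescribed permutation fixes the target of the even coordinate 2r only; the
    odd one is left with the other element of the block, as no right pin is joined to two left
    pins.\<close>
  have neq: "\<not> (joined a (Lpin (n - 2 * r)) t \<and> joined a (Lpin (n - (2 * r + 1))) t)" for t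
    using brauer_unique[OF a', of "Lpin (n - 2 * r)" t "Lpin (n - (2 * r + 1))"] c(1)
    unfolding joined_def by auto
  show "{Lpin (n - 2 * r), Rpin (n - slide X d p q (2 * r))} \<in> a"
    "{Lpin (n - (2 * r + 1)), Rpin (n - slide X d p q (2 * r + 1))} \<in> a"
    using sw 0 1 neq transpose_neq_id unfolding slide_block_coords[OF r] joined_def[symmetric]
    by (auto split: if_splits)
qed

text \<open>Conditions (1), (2), (3) are the cases p < 2, p even and p odd. The second element of
  the block of p is p+1 for even p, which is the pin j-1, and p-1 for odd p, which is the pin
  j+1.\<close>

lemma is_alpha_through:
  assumes a: "is_alpha n x y i j a" and u: "u < n" "u \<noteq> p" "u \<noteq> q"
  shows "{Lpin (n - u), Rpin (n - slide X d p q u)} \<in> a"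
proof -
  have c: "cond1 n i j a" "cond2 n i j a" "cond3 n i j a" using a unfolding is_alpha_def by simp_all
  consider (low) "u div 2 < p div 2" | (mate) "u div 2 = p div 2" | (high) "p div 2 < u div 2" by linarith
  then show ?thesis
  proof cases
    case low
    have "2 * Suc (u div 2) \<le> p"
      using div2_less_iff[of p "Suc (u div 2)"] low by simp
    note is_alpha_low[OF a this]
    moreover have "u = 2 * (u div 2) \<or> u = 2 * (u div 2) + 1" by linarith
    ultimately show ?thesis by metis
  next
    case mate
    then have h: "slide X d p q u = q" using u pq(1) by (intro slide_simps(4))
    have "joined a (Lpin (n - u)) (Rpin i)"
    proof (cases "p < 2")
      case True
      then have "u < 2" using mate block_less_iff[of u p 1] by simp
      have j: "j \<in> {n - 1, n}" "(i, j) \<noteq> (n - 1, n)" "{j, n - u} = {n - 1, n}"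
        using True \<open>u < 2\<close> u pq by auto
      with c(1) show ?thesis unfolding cond1_def by blast
    next
      case False
      then have j: "j \<le> n - 2" using pq by auto
      show ?thesis
      proof (cases "even p")
        case True
        then have "u = p + 1" using mate_unique[of u p] mate u(2) by (simp add: mate_def)
        then have "even j = even n" "n - u = j - 1" "i \<noteq> j - 1"
          using True pq u by auto
        with c(2) j show ?thesis unfolding cond2_def by metis
      next
        case odd: False
        then have "u = p - 1" using mate_unique[of u p] mate u(2) by (simp add: mate_def)
        then have "even j \<noteq> even n" "n - u = j + 1"
          using odd pq u by auto
        with c(3) j show ?thesis unfolding cond3_def by metis
      qed
    qed
    then show ?thesis unfolding h joined_def pq(4)[symmetric] .
  next
    case high
    then have h: "slide X d p q u = u" using u pq(1) by (intro slide_simps(5))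
    have "joined a (Lpin (n - u)) (Rpin (n - u))"
    proof (cases "p < 2")
      case True
      have "2 \<le> u" using high div2_less_iff[of u 1] by simp
      with True have j: "j \<in> {n - 1, n}" "n - u \<in> {1..n} - {i, n - 1, n}"
        using True u pq by auto
      with c(1) show ?thesis unfolding cond1_def by blast
    next
      case False
      then have j: "j \<le> n - 2" using pq by auto
      show ?thesis
      proof (cases "even p")
        case True
        then have "p + 2 \<le> u" using high div2_less_iff[of u "p div 2 + 1"] by simp
        then have "even j = even n" "n - u \<in> {1..j - 2} - {i}"
          using True pq u by auto
        with c(2) j show ?thesis unfolding cond2_def by blast
      next
        case odd: False
        have "\<not> u \<le> p" using high div_le_mono[of u p 2] by auto
        then have "p + 1 \<le> u" by simp
        then have "even j \<noteq> even n" "n - u \<in> {1..j - 1} - {i}"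
          using odd pq u by auto
        with c(3) j show ?thesis unfolding cond3_def by blast
      qed
    qed
    then show ?thesis unfolding h joined_def .
  qed
qed

lemma is_alpha_imp_canon:
  assumes a: "is_alpha n x y i j a"
  shows "a = canon n 1 (slide X d p q)"
proof (rule sym, rule brauer_subset_eq)
  let ?h = "slide X d p q"
  have h: "?h permutes {..<n}" using pq by (intro slide_permutes)
  have n: "2 * 1 \<le> n" using pq by simp
  show "canon n 1 ?h \<in> brauer n" using h n by (rule canon_in_brauer)
  show "a \<in> brauer n" using a unfolding is_alpha_def by simp
  have lt2: "u \<in> {p, q}" if "?h u < 2" for u
    using slide_high[of 0 p q u X d] pq(1) that by force
  have hpq: "?h p = 0" "?h q = 1" using pq(1) by (simp_all add: slide_simps)
  have LR: "{Lpin (n - u), Rpin (n - v)} \<in> a" if "u < n" "v < n" "{Lpin (n - u), Rpin (n - v)} \<in> canon n 1 ?h" for u v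
  proof -
    have "v = ?h u" "\<not> ?h u < 2" using that(3) unfolding canon_joined(3)[OF that(1,2)] code_eq_iff by auto
    moreover from this hpq have "u \<noteq> p" "u \<noteq> q" by auto
    ultimately show ?thesis using is_alpha_through[OF a that(1)] by simp
  qed
  have LL: "{Lpin (n - u), Lpin (n - v)} \<in> a" if "u < n" "v < n" "{Lpin (n - u), Lpin (n - v)} \<in> canon n 1 ?h" for u v
  proof -
    have "u \<noteq> v" "?h u < 2" "?h v < 2"
      using that(3) permutes_eq_iff[OF h, of u v] unfolding canon_joined(1)[OF that(1,2)] code_eq_iff by auto
    then have "{u, v} = {p, q}" using lt2[of u] lt2[of v] by auto
    moreover have "{Lpin i, Lpin j} \<in> a" using a unfolding is_alpha_def joined_def by simp
    ultimately show ?thesis unfolding pq(3,4) by (auto simp: doubleton_eq_iff insert_commute)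
  qed
  have RR: "{Rpin (n - u), Rpin (n - v)} \<in> a" if "u < n" "v < n" "{Rpin (n - u), Rpin (n - v)} \<in> canon n 1 ?h" for u v
  proof -
    have "u \<noteq> v" "u < 2" "v < 2"
      using that(3) unfolding canon_joined(2)[OF that(1,2)] code_eq_iff by auto
    then have "u = 0 \<and> v = 1 \<or> u = 1 \<and> v = 0" by auto
    moreover have "{Rpin (n - 1), Rpin n} \<in> a" using a unfolding is_alpha_def joined_def by simp
    ultimately show ?thesis by (auto simp: insert_commute)
  qed
  show "canon n 1 ?h \<subseteq> a"
  proof
    fix B assume "B \<in> canon n 1 ?h"
    then obtain s t where st: "B = {s, t}" "s \<in> pins n" "t \<in> pins n" "{s, t} \<in> canon n 1 ?h"
      unfolding canon_def labelled_def by blast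
    from st(2,3,4) have "{s, t} \<in> a"
      by (elim pins_cases) (simp_all add: LL LR RR insert_commute[of "Rpin _" "Lpin _"])
    with st(1) show "B \<in> a" by simp
  qed
qed

text \<open>The conditions on an alpha are consistent. In the proof, \<open>fixed\<close> and
  \<open>other\<close> yield (1) to (3): pins that keep their place, and the second pin of the block
  of j. \<open>low\<close> yields (4), (a) and (b).\<close>

lemma is_alpha_canon: "is_alpha n x y i j (canon n 1 (slide X d p q))"
proof -
  let ?h = "slide X d p q" and ?a = "canon n 1 (slide X d p q)"
  have h: "?h permutes {..<n}" using pq by (intro slide_permutes)
  have n: "2 * 1 \<le> n" using pq by simp
  have hpq: "?h p = 0" "?h q = 1" using pq(1) by (simp_all add: slide_simps)
  have LR: "joined ?a (Lpin (n - u)) (Rpin (n - v)) \<longleftrightarrow> ?h u = v \<and> \<not> v < 2" if "u < n" "v < n" for u v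
    unfolding joined_def canon_joined(3)[OF that] code_eq_iff by auto
  have fixed: "joined ?a (Lpin c) (Rpin c)" if "c \<le> n" "p div 2 < (n - c) div 2" "c \<noteq> i" "1 \<le> c" for c
  proof -
    have "n - c \<noteq> q" "n - c \<noteq> p" "n - (n - c) = c" "2 \<le> n - c" "n - c < n" using that ij unfolding q_def p_def by auto
    moreover from this that(2) have "?h (n - c) = n - c" using pq(1) by (intro slide_simps(5))
    ultimately show ?thesis using LR[of "n - c" "n - c"] by simp
  qed
  have other: "joined ?a (Lpin c) (Rpin i)" if "c \<le> n" "(n - c) div 2 = p div 2" "c \<noteq> i" "c \<noteq> j" "1 \<le> c" for c
  proof -
    have "n - c \<noteq> q" "n - c \<noteq> p" "n - (n - c) = c" "n - c < n" using that ij unfolding q_def p_def by auto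
    moreover from this that(2) have "?h (n - c) = q" using pq(1) by (intro slide_simps(4))
    moreover have "2 \<le> q" using calculation that(2) pq(1) by linarith
    ultimately show ?thesis using LR[of "n - c" q] pq by simp
  qed
  have "?a \<in> brauer n" using h n by (rule canon_in_brauer)
  moreover have "corank n ?a = 2" using corank_canon[OF h n] by simp
  moreover have "joined ?a (Lpin i) (Lpin j)"
    using canon_joined(1)[of q n p 1 ?h] pq hpq unfolding joined_def by (simp add: code_eq_iff)
  moreover have "joined ?a (Rpin (n - 1)) (Rpin n)"
    using canon_joined(2)[of 1 n 0 1 ?h] n unfolding joined_def by (simp add: code_eq_iff)
  moreover have "cond1 n i j ?a"
    unfolding cond1_def
  proof (intro impI conjI ballI allI)
    assume j: "j \<in> {n - 1, n}"
    then have p: "p div 2 = 0" unfolding p_def by auto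
    show "joined ?a (Lpin s) (Rpin s)" if "s \<in> {1..n} - {i, n - 1, n}" for s
      using that p by (intro fixed) (auto simp: div_greater_zero_iff)
    show "joined ?a (Lpin j') (Rpin i)" if "(i, j) \<noteq> (n - 1, n)" "{j, j'} = {n - 1, n}" for j'
    proof -
      have "j' \<in> {n - 1, n}" "j' \<noteq> j" using that(2) pq by (auto simp: doubleton_eq_iff)
      with that(1) j ij p show ?thesis by (intro other) (auto simp: div_eq_0_iff)
    qed
  qed
  moreover have "cond2 n i j ?a"
    unfolding cond2_def
  proof (intro impI conjI ballI)
    assume j: "j \<le> n - 2 \<and> even j = even n"
    then have p: "even p" "2 \<le> p" using ij unfolding p_def by auto
    show "joined ?a (Lpin s) (Rpin s)" if "s \<in> {1..j - 2} - {i}" for s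
    proof (rule fixed)
      have "p + 2 \<le> n - s" using that ij unfolding p_def by auto
      then show "p div 2 < (n - s) div 2" using div_le_mono[of "p + 2" "n - s" 2] by simp
    qed (use that ij in auto)
    show "joined ?a (Lpin (j - 1)) (Rpin i)" if "i \<noteq> j - 1"
    proof (rule other)
      have "n - (j - 1) = p + 1" using ij unfolding p_def by auto
      then show "(n - (j - 1)) div 2 = p div 2" using p by simp
    qed (use that ij in auto)
  qed
  moreover have "cond3 n i j ?a"
    unfolding cond3_def
  proof (intro impI conjI ballI)
    assume j: "j \<le> n - 2 \<and> even j \<noteq> even n"
    then have p: "odd p" "2 \<le> p" using ij unfolding p_def by auto
    show "joined ?a (Lpin s) (Rpin s)" if "s \<in> {1..j - 1} - {i}" for s
    proof (rule fixed)
      have "p + 1 \<le> n - s" using that ij unfolding p_def by auto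
      then have "(p + 1) div 2 \<le> (n - s) div 2" by (rule div_le_mono)
      then show "p div 2 < (n - s) div 2" using p by (auto elim!: oddE)
    qed (use that ij in auto)
    show "joined ?a (Lpin (j + 1)) (Rpin i)"
    proof (rule other)
      have "n - (j + 1) = p - 1" using ij unfolding p_def by auto
      then show "(n - (j + 1)) div 2 = p div 2" using p by (auto elim!: oddE)
    qed (use j ij p in auto)
  qed
  moreover have low: "joined ?a (Lpin (n - 2 * r)) (Rpin (n - (2 * r + 2))) \<longleftrightarrow> \<not> (X (Suc r) \<noteq> (d \<and> p div 2 \<noteq> q div 2))"
    "joined ?a (Lpin (n - 2 * r)) (Rpin (n - (2 * r + 3))) \<longleftrightarrow> X (Suc r) \<noteq> (d \<and> p div 2 \<noteq> q div 2)"
    "joined ?a (Lpin (n - (2 * r + 1))) (Rpin (n - (2 * r + 2))) \<longleftrightarrow> X (Suc r) \<noteq> (d \<and> p div 2 \<noteq> q div 2)"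
    "joined ?a (Lpin (n - (2 * r + 1))) (Rpin (n - (2 * r + 3))) \<longleftrightarrow> \<not> (X (Suc r) \<noteq> (d \<and> p div 2 \<noteq> q div 2))"
    if "2 * r + 3 < n" "2 * Suc r \<le> p" for r
  proof -
    have "2 * r < n" "2 * r + 1 < n" "2 * r + 2 < n" using that by auto
    note * = this that(1)
    show "joined ?a (Lpin (n - 2 * r)) (Rpin (n - (2 * r + 2))) \<longleftrightarrow> \<not> (X (Suc r) \<noteq> (d \<and> p div 2 \<noteq> q div 2))"
      unfolding LR[OF *(1,3)] slide_block_coords[OF that(2)] by auto
    show "joined ?a (Lpin (n - 2 * r)) (Rpin (n - (2 * r + 3))) \<longleftrightarrow> X (Suc r) \<noteq> (d \<and> p div 2 \<noteq> q div 2)"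
      unfolding LR[OF *(1,4)] slide_block_coords[OF that(2)] by auto
    show "joined ?a (Lpin (n - (2 * r + 1))) (Rpin (n - (2 * r + 2))) \<longleftrightarrow> X (Suc r) \<noteq> (d \<and> p div 2 \<noteq> q div 2)"
      unfolding LR[OF *(2,3)] slide_block_coords[OF that(2)] by auto
    show "joined ?a (Lpin (n - (2 * r + 1))) (Rpin (n - (2 * r + 3))) \<longleftrightarrow> \<not> (X (Suc r) \<noteq> (d \<and> p div 2 \<noteq> q div 2))"
      unfolding LR[OF *(2,4)] slide_block_coords[OF that(2)] by auto
  qed
  moreover have "cond4 n j ?a"
    unfolding cond4_def p_def[symmetric]
  proof (intro impI ballI)
    fix k s assume "k \<in> {1..p div 2}" and s: "s \<in> {n - 2 * k + 2, n - 2 * k + 1}"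
    from this(1) obtain r where r: "k = Suc r" "2 * r + 3 < n" "2 * k \<le> p"
      "n - 2 * k + 2 = n - 2 * r" "n - 2 * k + 1 = n - (2 * r + 1)"
      "n - 2 * k = n - (2 * r + 2)" "n - 2 * k - 1 = n - (2 * r + 3)"
      by (rule block_coords)
    from s show "\<exists>t\<in>{n - 2 * k, n - 2 * k - 1}. joined ?a (Lpin s) (Rpin t)"
      unfolding r(4,5) unfolding r(7) unfolding r(6) using low[OF r(2) r(3)[unfolded r(1)]] by blast
  qed
  moreover have "cond_a n x i j ?a \<and> cond_b n y i j ?a"
    unfolding cond_ab_iff
  proof
    fix s assume s: "s \<in> {1..p div 2}"
    then obtain r where r: "s = Suc r" "2 * r + 3 < n" "2 * s \<le> p"
      "n - 2 * s + 2 = n - 2 * r" "n - 2 * s + 1 = n - (2 * r + 1)"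
      "n - 2 * s = n - (2 * r + 2)" "n - 2 * s - 1 = n - (2 * r + 3)"
      by (rule block_coords)
    show "swap_part n ?a s = Z s"
      unfolding swap_part_def r(4) Z[OF s] unfolding r(7) unfolding r(6)
      unfolding low[OF r(2) r(3)[unfolded r(1)]] unfolding r(1) by auto
  qed
  ultimately show ?thesis unfolding is_alpha_def by blast
qed

lemma is_alpha_iff: "is_alpha n x y i j a \<longleftrightarrow> a = canon n 1 (slide X d p q)"
  using is_alpha_canon is_alpha_imp_canon by blast

end

lemma brauer_id_eq_canon: "brauer_id n = canon n 0 id"
proof (rule diagram_eqI)
  fix s t
  have "{Lpin (n - u), Rpin (n - v)} \<in> brauer_id n \<longleftrightarrow> u = v" if "u < n" "v < n" for u v
    using that unfolding brauer_id_def by (auto simp: doubleton_eq_iff)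
  then have LR: "{Lpin (n - u), Rpin (n - v)} \<in> brauer_id n \<longleftrightarrow> {Lpin (n - u), Rpin (n - v)} \<in> canon n 0 id"
    if "u < n" "v < n" for u v
    using that by (simp add: canon_joined(3) code_eq_iff)
  show "{s, t} \<in> brauer_id n \<longleftrightarrow> {s, t} \<in> canon n 0 id"
  proof (cases "s \<in> pins n \<and> t \<in> pins n")
    case True
    then have "s \<in> pins n" "t \<in> pins n" by auto
    moreover have "{Lpin u, Lpin v} \<notin> brauer_id n" "{Rpin u, Rpin v} \<notin> brauer_id n" for u v
      unfolding brauer_id_def by (auto simp: doubleton_eq_iff)
    ultimately show ?thesis
      by (elim pins_cases)
        (simp_all add: LR insert_commute[of "Rpin _" "Lpin _"] canon_joined(1,2) code_eq_iff)
  next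
    case False
    then have "{s, t} \<notin> brauer_id n"
      unfolding brauer_id_def by (auto simp: doubleton_eq_iff mem_pins)
    with False show ?thesis unfolding canon_def mem_labelled by blast
  qed
qed (auto simp: brauer_id_def canon_def labelled_def)

section \<open>Translation of x and y into the encoding by X and d\<close>

lemma permutes_two:
  assumes "\<sigma> permutes {1..2::nat}"
  shows "\<sigma> = id \<or> \<sigma> = transpose 1 2"
proof -
  have "\<sigma> permutes {1, 2}" using assms by (simp add: atLeastAtMost_insertL[symmetric] numeral_2_eq_2)
  then show ?thesis by (simp add: permutes_doubleton_iff)
qed

text \<open>Two distinct coordinates with the same half are 2k and 2k+1. The bound on
  \<open>n - j\<close> is there because the pair (n-1, n) is a block but does not belong to
  \<open>A_pairs\<close>.\<close>

lemma A_pairs_iff: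
  assumes "1 \<le> i" "i < j" "j \<le> n" "2 \<le> n - j"
  shows "(i, j) \<in> A_pairs n \<longleftrightarrow> (n - j) div 2 = (n - i) div 2"
proof
  assume "(i, j) \<in> A_pairs n"
  then obtain k where "i + 2 * k + 1 = n" "j + 2 * k = n" unfolding A_pairs_def by auto
  then have "n - j = 2 * k" "n - i = 2 * k + 1" by auto
  then show "(n - j) div 2 = (n - i) div 2" by simp
next
  assume eq: "(n - j) div 2 = (n - i) div 2"
  define k where "k = (n - j) div 2"
  have "n - j < n - i" using assms by auto
  then have "n - j = 2 * k" "n - i = 2 * k + 1" using eq unfolding k_def by linarith+
  moreover from this assms have "1 \<le> k" by auto
  ultimately show "(i, j) \<in> A_pairs n"
    using assms unfolding A_pairs_def by (auto intro!: exI[of _ k])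
qed

text \<open>\<open>alpha\<close> is a definite description, so the generated set means what it
  should only if each element exists and is unique; hence the first conjunct.\<close>

theorem proposition12:
  fixes n l m :: nat and x y :: "nat \<Rightarrow> nat \<Rightarrow> nat"
  assumes "l = (n - 2) div 2" and "m = (n - 3) div 2"
    and "\<forall>i\<in>{1..l}. x i permutes {1..2}"
    and "\<forall>i\<in>{1..m}. y i permutes {1..2}"
    and "\<forall>i. i \<in> {1..l} \<and> i + 1 \<in> {1..l} \<and> i \<in> {1..m} \<and> i + 1 \<in> {1..m} \<longrightarrow>
           x i \<circ> y (i + 1) = y i \<circ> x (i + 1)"
  shows "(\<forall>i j. 1 \<le> i \<and> i < j \<and> j \<le> n \<longrightarrow> (\<exists>!a. is_alpha n x y i j a)) \<and>
    canonical_R_cross_section n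
      (generated ({brauer_id n} \<union> {alpha n x y i j | i j. 1 \<le> i \<and> i < j \<and> j \<le> n}))"
proof -
  define X where "X s \<longleftrightarrow> x s \<noteq> id" for s
  define d where "d \<longleftrightarrow> x 1 \<noteq> y 1"
  have ml: "m \<le> l" using assms(1,2) by (simp add: div_le_mono)
  have x: "x s = (if X s then transpose 1 2 else id)" if "s \<in> {1..l}" for s
    using permutes_two[OF assms(3)[rule_format, OF that]] unfolding X_def by auto
  have y2: "y s = id \<or> y s = transpose 1 2" if "s \<in> {1..m}" for s
    using permutes_two[OF assms(4)[rule_format, OF that]] .
  have diff: "x s \<noteq> y s \<longleftrightarrow> d" if "1 \<le> s" "s \<le> m" for s
    using that
  proof (induction s rule: dec_induct)
    case base
    then show ?case by (simp add: d_def)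
  next
    case (step s)
    then have rel: "x s \<circ> y (Suc s) = y s \<circ> x (Suc s)" using assms(5) ml by simp
    have perm: "x s permutes {1..2}" "x (Suc s) permutes {1..2}"
      using assms(3) step ml by simp_all
    \<comment> \<open>Cancelling in the relation turns an equality at s into one at s+1 and
      conversely, so the value at 1 decides all of them.\<close>
    have "x s = y s \<longleftrightarrow> x (Suc s) = y (Suc s)"
    proof
      assume "x s = y s"
      with rel have "x s \<circ> y (Suc s) = x s \<circ> x (Suc s)" by simp
      then show "x (Suc s) = y (Suc s)"
        using permutes_inj[OF perm(1)] by (simp add: fun_eq_iff inj_eq)
    next
      assume "x (Suc s) = y (Suc s)"
      with rel have "x s \<circ> x (Suc s) = y s \<circ> x (Suc s)" by simp
      then have "x s \<circ> (x (Suc s) \<circ> inv (x (Suc s))) = y s \<circ> (x (Suc s) \<circ> inv (x (Suc s)))"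
        by (simp only: o_assoc)
      then show "x s = y s" by (simp add: permutes_inv_o[OF perm(2)])
    qed
    with step show ?case by simp
  qed
  have y: "y s = (if X s \<noteq> d then transpose 1 2 else id)" if "s \<in> {1..m}" for s
  proof -
    have "s \<in> {1..l}" "x s \<noteq> y s \<longleftrightarrow> d" using that ml diff by auto
    then show ?thesis using x[of s] y2[OF that] transpose_neq_id by (auto split: if_splits)
  qed
  have alpha: "is_alpha n x y i j a \<longleftrightarrow> a = canon n 1 (slide X d (n - j) (n - i))"
    if ij: "1 \<le> i" "i < j" "j \<le> n" for i j a
  proof (rule is_alpha_iff[OF ij])
    fix s assume s: "s \<in> {1..(n - j) div 2}"
    then have j: "2 \<le> n - j" by auto
    show "(if (i, j) \<in> A_pairs n then x else y) s =
      (if X s \<noteq> (d \<and> (n - j) div 2 \<noteq> (n - i) div 2) then transpose 1 2 else id)"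
    proof (cases "(i, j) \<in> A_pairs n")
      case True
      have "(n - j) div 2 \<le> (n - 2) div 2" using ij by (intro div_le_mono) auto
      then have "s \<in> {1..l}" using s assms(1) by simp
      with True x show ?thesis using A_pairs_iff[OF ij j] by simp
    next
      case False
      \<comment> \<open>For j = 2 the pair is (1, 2), which belongs to \<open>A_pairs\<close> when n
        is even; so n is odd here, and n-2 and n-3 have the same half. This is why the bound for y
        may be smaller than that for x.\<close>
      have "(n - j) div 2 \<le> (n - 3) div 2"
      proof (cases "j = 2")
        case True
        with ij have "i = 1" by simp
        have "odd n"
        proof
          assume "even n"
          then obtain b where "n = 2 * b" by (rule evenE)
          with True ij obtain c where "n = 2 * Suc c" by (cases b) auto
          with True \<open>i = 1\<close> have "(n - j) div 2 = (n - i) div 2" by simp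
          with False A_pairs_iff[OF ij j] show False by simp
        qed
        then obtain b where "n = 2 * b + 1" by (rule oddE)
        with True ij obtain c where "n = 2 * Suc c + 1" by (cases b) auto
        with True show ?thesis by simp
      next
        case False
        with ij have "n - j \<le> n - 3" by auto
        then show ?thesis by (rule div_le_mono)
      qed
      then have "s \<in> {1..m}" using s assms(2) by simp
      with False y show ?thesis using A_pairs_iff[OF ij j] by simp
    qed
  qed
  have alpha_eq: "alpha n x y i j = canon n 1 (slide X d (n - j) (n - i))"
    if "1 \<le> i" "i < j" "j \<le> n" for i j
    unfolding alpha_def by (rule the_equality) (simp_all only: alpha[OF that])
  have "{alpha n x y i j | i j. 1 \<le> i \<and> i < j \<and> j \<le> n} =
      {canon n 1 (slide X d p q) | p q. p < q \<and> q < n}" (is "?A = ?B")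
  proof
    show "?A \<subseteq> ?B"
    proof
      fix a assume "a \<in> ?A"
      then obtain i j where ij: "a = alpha n x y i j" "1 \<le> i" "i < j" "j \<le> n" by blast
      then have "n - j < n - i" "n - i < n" by auto
      with ij show "a \<in> ?B" using alpha_eq by blast
    qed
    show "?B \<subseteq> ?A"
    proof
      fix a assume "a \<in> ?B"
      then obtain p q where pq: "a = canon n 1 (slide X d p q)" "p < q" "q < n" by blast
      then have "a = alpha n x y (n - q) (n - p)" "1 \<le> n - q" "n - q < n - p" "n - p \<le> n"
        using alpha_eq[of "n - q" "n - p"] by auto
      then show "a \<in> ?A" by blast
    qed
  qed
  then have "generated ({brauer_id n} \<union> ?A) = cross_section X d n"
    unfolding brauer_id_eq_canon using generated_eq_cross_section by simp
  with canonical_cross_section alpha show ?thesis by simp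
qed

end
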